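(* Let $P$ be a projection algebra, let $S$ be any projection-generated regular $*$-semigroup with $P=\mathsf P(S)$, and let $p_0\in P$ be arbitrary. Let $D$ be the $\mathscr D$-class of $S$ containing $p_0$, let $P_D=P\cap D$, and let $T$ be any $p_0$-rooted directed spanning tree for the digraph $\mathscr F_D$. Then the maximal subgroup of $\mathsf{PG}(P)$ containing $x_{p_0}$ is defined by the group presentation with generators $\{a_{p,q} : (p,q)\in\mathscr F_D\}$ and relations \begin{align*} &a_{p,q}=1 && \text{for every edge } (p,q) \text{ of } T,\\ &a_{p,p}=1 && \text{for all } p\in P_D,\\ &a_{p,q}=a_{q,p}^{-1} && \text{for all } (p,q)\in\mathscr F_D,\\ &a_{u,s}a_{s,w}=a_{u,w} && \text{for all linked triangles } (s,u,w) \text{ in } P_D. \end{align*}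
   Context: A regular $*$-semigroup is a semigroup $S$ with a unary operation $a\mapsto a^*$ satisfying $(a^* )^*=a=aa^*a$ and $(ab)^*=b^*a^*$. A projection is an element $p$ with $p^2=p=p^*$; $\mathsf P(S)$ is the set of projections, and for $p,q\in \mathsf P(S)$ one has $pqp\in \mathsf P(S)$. The set $P=\mathsf P(S)$ with the unary operations $q\mapsto pqp$ ($p\in P$) is the projection algebra of $S$; every (abstract) projection algebra is of this form. $S$ is projection-generated if it is generated as a semigroup by $\mathsf P(S)$. $\mathsf{PG}(P)$ is the semigroup defined by the semigroup presentation with generators $x_p$ ($p\in P$) and relations $x_p^2=x_p$, $(x_px_q)^2=x_px_q$, $x_px_qx_p=x_{pqp}$ ($p,q\in P$). The maximal subgroup containing the idempotent $x_{p_0}$ is its $\mathscr H$-class in $\mathsf{PG}(P)$. The friendliness relation is $\mathscr F=\{(p,q)\in P\times P: pqp=p,\ qpq=q\}$, and $\mathscr F_D=\mathscr F\cap(P_D\times P_D)$, regarded as a symmetric digraph with vertex set $P_D$ (it is strongly connected). A $p_0$-rooted directed spanning tree of $\mathscr F_D$ is a subgraph on all of $P_D$ whose underlying undirected graph is a tree and in which there is a directed path from $p_0$ to every other vertex. A triple $(s,u,w)$ of elements of $P_D$ is a linked triangle if $(s,w),(u,s),(u,w)\in\mathscr F_D$ and there exists $p\in P$ such that $psp=s$ and $pup=w$. *)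

theory Defs
  imports "HOL-Algebra.Group"
begin

section \<open>Semigroups and Green's relations\<close>

record 'a semigrp = "'a partial_object" +
  sprod :: "['a, 'a] \<Rightarrow> 'a"  (infixl "\<cdot>\<index>" 70)

record 'a star_semigrp = "'a semigrp" +
  star :: "'a \<Rightarrow> 'a"

locale is_semigroup =
  fixes S (structure)
  assumes sprod_closed: "a \<in> carrier S \<Longrightarrow> b \<in> carrier S \<Longrightarrow> a \<cdot> b \<in> carrier S"
    and sprod_assoc: "a \<in> carrier S \<Longrightarrow> b \<in> carrier S \<Longrightarrow> c \<in> carrier S
          \<Longrightarrow> (a \<cdot> b) \<cdot> c = a \<cdot> (b \<cdot> c)"

text \<open>The one-sided principal ideals \<open>S\<^sup>1a\<close> and \<open>aS\<^sup>1\<close>.\<close>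

definition left_ideal :: "('a, 'm) semigrp_scheme \<Rightarrow> 'a \<Rightarrow> 'a set" where
  "left_ideal S a = insert a {x \<cdot>\<^bsub>S\<^esub> a | x. x \<in> carrier S}"

definition right_ideal :: "('a, 'm) semigrp_scheme \<Rightarrow> 'a \<Rightarrow> 'a set" where
  "right_ideal S a = insert a {a \<cdot>\<^bsub>S\<^esub> x | x. x \<in> carrier S}"

definition green_L :: "('a, 'm) semigrp_scheme \<Rightarrow> ('a \<times> 'a) set" where
  "green_L S = {(a, b). a \<in> carrier S \<and> b \<in> carrier S \<and> left_ideal S a = left_ideal S b}"

definition green_R :: "('a, 'm) semigrp_scheme \<Rightarrow> ('a \<times> 'a) set" where
  "green_R S = {(a, b). a \<in> carrier S \<and> b \<in> carrier S \<and> right_ideal S a = right_ideal S b}"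

definition green_H :: "('a, 'm) semigrp_scheme \<Rightarrow> ('a \<times> 'a) set" where
  "green_H S = green_L S \<inter> green_R S"

text \<open>\<open>\<L>\<close> and \<open>\<R>\<close> commute, so the composite is their join.\<close>

definition green_D :: "('a, 'm) semigrp_scheme \<Rightarrow> ('a \<times> 'a) set" where
  "green_D S = green_L S O green_R S"

text \<open>Intended for idempotent \<open>e\<close>, in which case the \<open>\<H>\<close>-class of \<open>e\<close> is a group with
  identity \<open>e\<close>.\<close>

definition maximal_subgroup :: "('a, 'm) semigrp_scheme \<Rightarrow> 'a \<Rightarrow> 'a monoid" where
  "maximal_subgroup S e =
     \<lparr>carrier = green_H S `` {e}, monoid.mult = sprod S, one = e\<rparr>"

inductive_set subsemigroup_generated :: "('a, 'm) semigrp_scheme \<Rightarrow> 'a set \<Rightarrow> 'a set"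
  for S :: "('a, 'm) semigrp_scheme" and A :: "'a set" where
  incl: "a \<in> A \<Longrightarrow> a \<in> subsemigroup_generated S A"
| prod: "a \<in> subsemigroup_generated S A \<Longrightarrow> b \<in> subsemigroup_generated S A
           \<Longrightarrow> a \<cdot>\<^bsub>S\<^esub> b \<in> subsemigroup_generated S A"


section \<open>Regular star-semigroups and projection algebras\<close>

locale regular_star_semigroup = is_semigroup S for S (structure) +
  assumes star_closed: "a \<in> carrier S \<Longrightarrow> star S a \<in> carrier S"
    and star_star: "a \<in> carrier S \<Longrightarrow> star S (star S a) = a"
    and star_regular: "a \<in> carrier S \<Longrightarrow> a \<cdot> star S a \<cdot> a = a"
    and star_sprod: "a \<in> carrier S \<Longrightarrow> b \<in> carrier S
          \<Longrightarrow> star S (a \<cdot> b) = star S b \<cdot> star S a"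

definition projections :: "('a, 'm) star_semigrp_scheme \<Rightarrow> 'a set" where
  "projections S = {p \<in> carrier S. p \<cdot>\<^bsub>S\<^esub> p = p \<and> star S p = p}"

definition projection_generated :: "('a, 'm) star_semigrp_scheme \<Rightarrow> bool" where
  "projection_generated S \<longleftrightarrow> subsemigroup_generated S (projections S) = carrier S"

text \<open>\<open>act P p\<close> is the unary operation of \<open>P\<close> indexed by \<open>p\<close>, often written \<open>\<theta>\<^sub>p\<close> and applied
  on the right: \<open>act P p q\<close> is \<open>q\<theta>\<^sub>p\<close>, so that in a regular star-semigroup it is \<open>pqp\<close>.\<close>

record 'a proj_algebra = "'a partial_object" +
  act :: "'a \<Rightarrow> 'a \<Rightarrow> 'a"

locale projection_algebra =
  fixes P :: "('a, 'm) proj_algebra_scheme"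
  assumes act_closed: "p \<in> carrier P \<Longrightarrow> q \<in> carrier P \<Longrightarrow> act P p q \<in> carrier P"
    and act_self: "p \<in> carrier P \<Longrightarrow> act P p p = p"
    and act_idem: "p \<in> carrier P \<Longrightarrow> q \<in> carrier P \<Longrightarrow> act P p (act P p q) = act P p q"
    and act_swap: "p \<in> carrier P \<Longrightarrow> q \<in> carrier P \<Longrightarrow> act P p (act P q p) = act P p q"
    and act_act: "p \<in> carrier P \<Longrightarrow> q \<in> carrier P \<Longrightarrow> r \<in> carrier P
          \<Longrightarrow> act P p (act P q (act P p r)) = act P (act P p q) r"
    and act_pair_idem: "p \<in> carrier P \<Longrightarrow> q \<in> carrier P \<Longrightarrow> r \<in> carrier P
          \<Longrightarrow> act P q (act P p (act P q (act P p r))) = act P q (act P p r)"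

text \<open>\<open>P = P(S)\<close> as projection algebras; the values of \<open>act P\<close> outside \<open>carrier P\<close> are
  irrelevant.\<close>

definition is_projection_algebra_of ::
  "('a, 'n) proj_algebra_scheme \<Rightarrow> ('a, 'm) star_semigrp_scheme \<Rightarrow> bool" where
  "is_projection_algebra_of P S \<longleftrightarrow>
     carrier P = projections S \<and>
     (\<forall>p \<in> carrier P. \<forall>q \<in> carrier P. act P p q = p \<cdot>\<^bsub>S\<^esub> q \<cdot>\<^bsub>S\<^esub> p)"

definition friendly :: "('a, 'm) proj_algebra_scheme \<Rightarrow> ('a \<times> 'a) set" where
  "friendly P = {(p, q). p \<in> carrier P \<and> q \<in> carrier P \<and> act P p q = p \<and> act P q p = q}"

definition friendly_on :: "('a, 'm) proj_algebra_scheme \<Rightarrow> 'a set \<Rightarrow> ('a \<times> 'a) set" where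
  "friendly_on P V = friendly P \<inter> (V \<times> V)"

definition linked_triangle ::
  "('a, 'm) proj_algebra_scheme \<Rightarrow> 'a set \<Rightarrow> 'a \<Rightarrow> 'a \<Rightarrow> 'a \<Rightarrow> bool" where
  "linked_triangle P V s u w \<longleftrightarrow>
     s \<in> V \<and> u \<in> V \<and> w \<in> V \<and>
     (s, w) \<in> friendly_on P V \<and> (u, s) \<in> friendly_on P V \<and> (u, w) \<in> friendly_on P V \<and>
     (\<exists>p \<in> carrier P. act P p s = s \<and> act P p u = w)"


section \<open>Rooted directed spanning trees\<close>

text \<open>The vertex set may be infinite. An undirected edge is a two-element set of vertices.\<close>

definition undirected_tree :: "'a set \<Rightarrow> 'a set set \<Rightarrow> bool" where
  "undirected_tree V E \<longleftrightarrow>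
     V \<noteq> {} \<and>
     E \<subseteq> {{u, v} | u v. u \<in> V \<and> v \<in> V \<and> u \<noteq> v} \<and>
     (\<forall>u \<in> V. \<forall>v \<in> V. (u, v) \<in> {(x, y). {x, y} \<in> E}\<^sup>*) \<and>
     \<not> (\<exists>vs. 3 \<le> length vs \<and> distinct vs \<and>
           (\<forall>i < length vs. {vs ! i, vs ! (Suc i mod length vs)} \<in> E))"

text \<open>Digraphs are given by vertex set \<open>V\<close> and edge set; \<open>T\<close> is the edge set of the tree. A loop
  in \<open>T\<close> gives a one-element set on the undirected side, so it is excluded by
  \<^const>\<open>undirected_tree\<close>. Opposite edges \<open>(p, q)\<close> and \<open>(q, p)\<close> give the same undirected edge
  and are not excluded.\<close>

definition rooted_spanning_tree ::
  "'a set \<Rightarrow> ('a \<times> 'a) set \<Rightarrow> 'a \<Rightarrow> ('a \<times> 'a) set \<Rightarrow> bool" where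
  "rooted_spanning_tree V E r T \<longleftrightarrow>
     T \<subseteq> E \<and> r \<in> V \<and>
     undirected_tree V {{p, q} | p q. (p, q) \<in> T} \<and>
     (\<forall>v \<in> V. (r, v) \<in> T\<^sup>*)"


section \<open>Presentations\<close>

text \<open>The congruence generated by the relations \<open>R\<close> on a set \<open>W\<close> of words closed under
  concatenation.\<close>

inductive_set word_cong :: "'x list set \<Rightarrow> ('x list \<times> 'x list) set \<Rightarrow> ('x list \<times> 'x list) set"
  for W :: "'x list set" and R :: "('x list \<times> 'x list) set" where
  base: "(u, v) \<in> R \<Longrightarrow> u \<in> W \<Longrightarrow> v \<in> W \<Longrightarrow> (u, v) \<in> word_cong W R"
| refl: "u \<in> W \<Longrightarrow> (u, u) \<in> word_cong W R"
| sym: "(u, v) \<in> word_cong W R \<Longrightarrow> (v, u) \<in> word_cong W R"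
| trans: "(u, v) \<in> word_cong W R \<Longrightarrow> (v, w) \<in> word_cong W R \<Longrightarrow> (u, w) \<in> word_cong W R"
| append: "(u, v) \<in> word_cong W R \<Longrightarrow> (u', v') \<in> word_cong W R
             \<Longrightarrow> (u @ u', v @ v') \<in> word_cong W R"

definition class_mult :: "('x list \<times> 'x list) set \<Rightarrow> 'x list set \<Rightarrow> 'x list set \<Rightarrow> 'x list set" where
  "class_mult C A B = (\<Union>u \<in> A. \<Union>v \<in> B. C `` {u @ v})"

definition semigroup_words :: "'x set \<Rightarrow> 'x list set" where
  "semigroup_words X = lists X - {[]}"

definition semigroup_presentation ::
  "'x set \<Rightarrow> ('x list \<times> 'x list) set \<Rightarrow> 'x list set semigrp" where
  "semigroup_presentation X R =
     (let C = word_cong (semigroup_words X) R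
      in \<lparr>carrier = semigroup_words X // C, sprod = class_mult C\<rparr>)"

text \<open>Group words are words in the letters \<open>(y, True)\<close>, standing for the generator \<open>y\<close>, and
  \<open>(y, False)\<close>, standing for its formal inverse.\<close>

definition group_words :: "'y set \<Rightarrow> ('y \<times> bool) list set" where
  "group_words Y = lists (Y \<times> UNIV)"

definition cancellations :: "'y set \<Rightarrow> (('y \<times> bool) list \<times> ('y \<times> bool) list) set" where
  "cancellations Y = {([(y, b), (y, \<not> b)], []) | y b. y \<in> Y}"

definition group_presentation ::
  "'y set \<Rightarrow> (('y \<times> bool) list \<times> ('y \<times> bool) list) set \<Rightarrow> ('y \<times> bool) list set monoid" where
  "group_presentation Y R =
     (let C = word_cong (group_words Y) (cancellations Y \<union> R)
      in \<lparr>carrier = group_words Y // C, monoid.mult = class_mult C, one = C `` {[]}\<rparr>)"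


section \<open>The semigroup \<open>PG(P)\<close> and the presentation of its maximal subgroups\<close>

definition PG_rels :: "('a, 'm) proj_algebra_scheme \<Rightarrow> ('a list \<times> 'a list) set" where
  "PG_rels P =
     {([p, p], [p]) | p. p \<in> carrier P} \<union>
     {([p, q, p, q], [p, q]) | p q. p \<in> carrier P \<and> q \<in> carrier P} \<union>
     {([p, q, p], [act P p q]) | p q. p \<in> carrier P \<and> q \<in> carrier P}"

definition PG :: "('a, 'm) proj_algebra_scheme \<Rightarrow> 'a list set semigrp" where
  "PG P = semigroup_presentation (carrier P) (PG_rels P)"

definition PG_gen :: "('a, 'm) proj_algebra_scheme \<Rightarrow> 'a \<Rightarrow> 'a list set" where
  "PG_gen P p = word_cong (semigroup_words (carrier P)) (PG_rels P) `` {[p]}"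

abbreviation gen :: "'a \<Rightarrow> 'a \<Rightarrow> ('a \<times> 'a) \<times> bool" where
  "gen p q \<equiv> ((p, q), True)"

abbreviation gen_inv :: "'a \<Rightarrow> 'a \<Rightarrow> ('a \<times> 'a) \<times> bool" where
  "gen_inv p q \<equiv> ((p, q), False)"

definition subgroup_rels ::
  "('a, 'm) proj_algebra_scheme \<Rightarrow> 'a set \<Rightarrow> ('a \<times> 'a) set
     \<Rightarrow> ((('a \<times> 'a) \<times> bool) list \<times> (('a \<times> 'a) \<times> bool) list) set" where
  "subgroup_rels P V T =
     {([gen p q], []) | p q. (p, q) \<in> T} \<union>
     {([gen p p], []) | p. p \<in> V} \<union>
     {([gen p q], [gen_inv q p]) | p q. (p, q) \<in> friendly_on P V} \<union>
     {([gen u s, gen s w], [gen u w]) | s u w. linked_triangle P V s u w}"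


section \<open>The constructions are well defined\<close>

lemma (in regular_star_semigroup) projections_idem:
  assumes "p \<in> projections S" "q \<in> projections S"
  shows "p \<cdot> q \<cdot> p \<cdot> q = p \<cdot> q"
proof -
  have c: "p \<in> carrier S" "q \<in> carrier S" "p \<cdot> p = p" "q \<cdot> q = q" "star S p = p" "star S q = q"
    using assms by (auto simp: projections_def)
  have "(p \<cdot> q) \<cdot> (q \<cdot> p) \<cdot> (p \<cdot> q) = p \<cdot> q"
    using star_regular[of "p \<cdot> q"] c by (simp add: star_sprod sprod_closed)
  moreover have "(p \<cdot> q) \<cdot> (q \<cdot> p) \<cdot> (p \<cdot> q) = p \<cdot> (q \<cdot> q) \<cdot> (p \<cdot> p) \<cdot> q"
    using c(1,2) by (simp add: sprod_assoc sprod_closed)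
  ultimately show ?thesis using c by simp
qed

lemma (in regular_star_semigroup) projections_left_absorb:
  assumes "p \<in> projections S" "q \<in> projections S" "x \<in> carrier S"
  shows "p \<cdot> (q \<cdot> (p \<cdot> (q \<cdot> x))) = p \<cdot> (q \<cdot> x)" "p \<cdot> (p \<cdot> x) = p \<cdot> x"
proof -
  have c: "p \<in> carrier S" "q \<in> carrier S" "p \<cdot> p = p"
    using assms by (auto simp: projections_def)
  have "p \<cdot> q \<cdot> p \<cdot> q \<cdot> x = p \<cdot> q \<cdot> x" using projections_idem[OF assms(1,2)] by simp
  then show "p \<cdot> (q \<cdot> (p \<cdot> (q \<cdot> x))) = p \<cdot> (q \<cdot> x)"
    using c assms(3) by (simp add: sprod_assoc sprod_closed)
  have "p \<cdot> p \<cdot> x = p \<cdot> x" using c by simp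
  then show "p \<cdot> (p \<cdot> x) = p \<cdot> x" using sprod_assoc[OF c(1,1) assms(3)] by simp
qed

lemma (in regular_star_semigroup) is_projection_algebra_of_imp:
  assumes "is_projection_algebra_of P S"
  shows "projection_algebra P"
proof -
  have cP: "carrier P = projections S" and sub: "\<And>p. p \<in> projections S \<Longrightarrow> p \<in> carrier S"
    using assms by (auto simp: is_projection_algebra_of_def projections_def)
  have pp: "\<And>p. p \<in> projections S \<Longrightarrow> p \<cdot> p = p" "\<And>p. p \<in> projections S \<Longrightarrow> star S p = p"
    by (auto simp: projections_def)
  have cl: "p \<cdot> (q \<cdot> p) \<in> projections S" if "p \<in> projections S" "q \<in> projections S" for p q
  proof -
    have "(p \<cdot> (q \<cdot> p)) \<cdot> (p \<cdot> (q \<cdot> p)) = p \<cdot> (q \<cdot> p)"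
      using that by (simp add: sub pp sprod_assoc sprod_closed projections_left_absorb)
    moreover have "star S (p \<cdot> (q \<cdot> p)) = p \<cdot> (q \<cdot> p)"
      using that by (simp add: sub pp sprod_assoc sprod_closed star_sprod)
    ultimately show ?thesis using that by (simp add: projections_def sprod_closed)
  qed
  have a: "act P p q = p \<cdot> (q \<cdot> p)" if "p \<in> projections S" "q \<in> projections S" for p q
    using assms that unfolding is_projection_algebra_of_def cP by (simp add: sub sprod_assoc)
  have i: "p \<cdot> (q \<cdot> (p \<cdot> q)) = p \<cdot> q" if "p \<in> projections S" "q \<in> projections S" for p q
    using projections_idem[OF that] that by (simp add: sub sprod_assoc sprod_closed)
  show ?thesis
    by unfold_locales (simp_all add: cP a cl,
        simp_all add: i sub pp sprod_assoc sprod_closed projections_left_absorb)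
qed

lemma word_cong_in: 
  assumes "\<And>u v. u \<in> W \<Longrightarrow> v \<in> W \<Longrightarrow> u @ v \<in> W" "(u, v) \<in> word_cong W R"
  shows "u \<in> W \<and> v \<in> W"
  using assms(2) by induction (auto intro: assms(1))

lemma word_cong_equiv:
  assumes "\<And>u v. u \<in> W \<Longrightarrow> v \<in> W \<Longrightarrow> u @ v \<in> W"
  shows "equiv W (word_cong W R)"
  using word_cong_in[OF assms]
  by (intro equivI refl_onI symI transI) (auto intro: word_cong.intros)

lemma class_mult_class:
  fixes R :: "('x list \<times> 'x list) set"
  assumes W: "\<And>u v. u \<in> W \<Longrightarrow> v \<in> W \<Longrightarrow> u @ v \<in> W" and "u \<in> W" "v \<in> W"
  shows "class_mult (word_cong W R) (word_cong W R `` {u}) (word_cong W R `` {v}) = word_cong W R `` {u @ v}"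
proof -
  define C where C_def: "C = word_cong W R"
  have e: "equiv W C" unfolding C_def by (rule word_cong_equiv[OF W])
  have "C `` {x @ y} = C `` {u @ v}" if "x \<in> C `` {u}" "y \<in> C `` {v}" for x y
    using that equiv_class_eq[OF e] word_cong.sym word_cong.append unfolding C_def
    by (metis Image_singleton_iff)
  moreover have "u \<in> C `` {u}" "v \<in> C `` {v}" using assms(2,3) by (simp_all add: C_def word_cong.refl)
  ultimately show ?thesis unfolding class_mult_def C_def[symmetric] by blast
qed

lemma semigroup_presentation_is_semigroup: "is_semigroup (semigroup_presentation X R)"
proof -
  let ?W = "semigroup_words X"
  have W: "\<And>u v. u \<in> ?W \<Longrightarrow> v \<in> ?W \<Longrightarrow> u @ v \<in> ?W" by (auto simp: semigroup_words_def)
  show ?thesis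
    by unfold_locales (auto simp: semigroup_presentation_def Let_def elim!: quotientE
       simp: class_mult_class[OF W] W quotientI)
qed

lemma group_presentation_is_group: "group (group_presentation Y R)"
proof -
  let ?W = "group_words Y"
  let ?C = "word_cong ?W (cancellations Y \<union> R)"
  have W: "\<And>u v. u \<in> ?W \<Longrightarrow> v \<in> ?W \<Longrightarrow> u @ v \<in> ?W" and N: "[] \<in> ?W" 
    by (auto simp: group_words_def)
  note e = word_cong_equiv[OF W, where R="cancellations Y \<union> R"]
  have inv: "\<exists>v \<in> ?W. (v @ u, []) \<in> ?C" if "u \<in> ?W" for u
    using that
  proof (induction u)
    case Nil then show ?case using N by (auto intro: word_cong.intros)
  next
    case (Cons a u)
    obtain y b where a: "a = (y, b)" by force
    have u: "u \<in> ?W" and y: "y \<in> Y" using Cons a by (auto simp: group_words_def)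
    obtain v where v: "v \<in> ?W" "(v @ u, []) \<in> ?C" using Cons u by auto
    have "([(y, \<not>b), (y, b)], []) \<in> ?C"
      by (rule word_cong.base) (use y in \<open>auto simp: cancellations_def group_words_def\<close>)
    then have "((v @ [(y, \<not>b), (y, b)]) @ u, (v @ []) @ u) \<in> ?C"
      using u v by (intro word_cong.append) (auto intro: word_cong.intros)
    then have "((v @ [(y, \<not>b)]) @ (a # u), []) \<in> ?C"
      using v a by (auto intro: word_cong.trans)
    moreover have "v @ [(y, \<not>b)] \<in> ?W" using v y by (auto simp: group_words_def)
    ultimately show ?case by blast
  qed
  show ?thesis
  proof (rule groupI; unfold group_presentation_def Let_def; simp)
    show "\<And>x y. x \<in> ?W // ?C \<Longrightarrow> y \<in> ?W // ?C \<Longrightarrow> class_mult ?C x y \<in> ?W // ?C"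
      by (auto elim!: quotientE simp: class_mult_class[OF W] W quotientI)
    show "?C `` {[]} \<in> ?W // ?C" using N by (rule quotientI)
    show "\<And>x y z. x \<in> ?W // ?C \<Longrightarrow> y \<in> ?W // ?C \<Longrightarrow> z \<in> ?W // ?C \<Longrightarrow>
       class_mult ?C (class_mult ?C x y) z = class_mult ?C x (class_mult ?C y z)"
      by (auto elim!: quotientE simp: class_mult_class[OF W] W)
    show "\<And>x. x \<in> ?W // ?C \<Longrightarrow> class_mult ?C (?C `` {[]}) x = x"
      using N by (auto elim!: quotientE simp: class_mult_class[OF W] W)
    fix x assume "x \<in> ?W // ?C"
    then obtain u where u: "u \<in> ?W" "x = ?C `` {u}" by (auto elim: quotientE)
    then obtain v where v: "v \<in> ?W" "(v @ u, []) \<in> ?C" using inv by blast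
    have "class_mult ?C (?C `` {v}) x = ?C `` {[]}"
      using u v equiv_class_eq[OF e] by (simp add: class_mult_class[OF W])
    then show "\<exists>y\<in>?W // ?C. class_mult ?C y x = ?C `` {[]}" using v by (meson quotientI)
  qed
qed

lemma (in is_semigroup) maximal_subgroup_is_group:
  assumes e: "e \<in> carrier S" "e \<cdot> e = e"
  shows "group (maximal_subgroup S e)"
proof -
  have L: "(e, a) \<in> green_L S \<longleftrightarrow> a \<in> carrier S \<and> a \<cdot> e = a \<and> (\<exists>x\<in>carrier S. x \<cdot> a = e)" for a
  proof
    assume "(e, a) \<in> green_L S"
    then have a: "a \<in> carrier S" "left_ideal S e = left_ideal S a" by (auto simp: green_L_def)
    have "a \<in> left_ideal S e" "e \<in> left_ideal S a" using a by (auto simp: left_ideal_def)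
    then show "a \<in> carrier S \<and> a \<cdot> e = a \<and> (\<exists>x\<in>carrier S. x \<cdot> a = e)"
      using a e unfolding left_ideal_def
      by (smt (verit) insert_iff mem_Collect_eq sprod_assoc)
  next
    assume "a \<in> carrier S \<and> a \<cdot> e = a \<and> (\<exists>x\<in>carrier S. x \<cdot> a = e)"
    then obtain x where a: "a \<in> carrier S" "a \<cdot> e = a" and x: "x \<in> carrier S" "x \<cdot> a = e" by blast
    have "y \<cdot> a \<in> left_ideal S e" if "y \<in> carrier S" for y
      using that a e unfolding left_ideal_def
      by (metis (mono_tags, lifting) insertCI mem_Collect_eq sprod_assoc sprod_closed)
    moreover have "y \<cdot> e \<in> left_ideal S a" if "y \<in> carrier S" for y
    proof -
      have "y \<cdot> e = (y \<cdot> x) \<cdot> a" using that a x by (simp add: sprod_assoc)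
      then show ?thesis using that x sprod_closed unfolding left_ideal_def by blast
    qed
    moreover have "a \<in> left_ideal S e" "e \<in> left_ideal S a"
      unfolding left_ideal_def using a x by (metis (mono_tags, lifting) insertCI mem_Collect_eq)+
    ultimately have "left_ideal S e = left_ideal S a"
      unfolding left_ideal_def by blast
    then show "(e, a) \<in> green_L S" using a e by (simp add: green_L_def)
  qed
  have R: "(e, a) \<in> green_R S \<longleftrightarrow> a \<in> carrier S \<and> e \<cdot> a = a \<and> (\<exists>x\<in>carrier S. a \<cdot> x = e)" for a
  proof
    assume "(e, a) \<in> green_R S"
    then have a: "a \<in> carrier S" "right_ideal S e = right_ideal S a" by (auto simp: green_R_def)
    have "a \<in> right_ideal S e" "e \<in> right_ideal S a" using a by (auto simp: right_ideal_def)
    then show "a \<in> carrier S \<and> e \<cdot> a = a \<and> (\<exists>x\<in>carrier S. a \<cdot> x = e)"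
      using a e unfolding right_ideal_def
      by (smt (verit) insert_iff mem_Collect_eq sprod_assoc)
  next
    assume "a \<in> carrier S \<and> e \<cdot> a = a \<and> (\<exists>x\<in>carrier S. a \<cdot> x = e)"
    then obtain x where a: "a \<in> carrier S" "e \<cdot> a = a" and x: "x \<in> carrier S" "a \<cdot> x = e" by blast
    have "a \<cdot> y \<in> right_ideal S e" if "y \<in> carrier S" for y
      using that a e unfolding right_ideal_def
      by (metis (mono_tags, lifting) insertCI mem_Collect_eq sprod_assoc sprod_closed)
    moreover have "e \<cdot> y \<in> right_ideal S a" if "y \<in> carrier S" for y
    proof -
      have "e \<cdot> y = a \<cdot> (x \<cdot> y)" using that a x by (simp add: sprod_assoc[symmetric])
      then show ?thesis using that x sprod_closed unfolding right_ideal_def by blast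
    qed
    moreover have "a \<in> right_ideal S e" "e \<in> right_ideal S a"
      unfolding right_ideal_def using a x by (metis (mono_tags, lifting) insertCI mem_Collect_eq)+
    ultimately have "right_ideal S e = right_ideal S a"
      unfolding right_ideal_def by blast
    then show "(e, a) \<in> green_R S" using a e by (simp add: green_R_def)
  qed
  have H: "a \<in> carrier (maximal_subgroup S e) \<longleftrightarrow> a \<in> carrier S \<and> e \<cdot> a = a \<and> a \<cdot> e = a \<and>
      (\<exists>x\<in>carrier S. x \<cdot> a = e) \<and> (\<exists>x\<in>carrier S. a \<cdot> x = e)" for a
    by (auto simp: maximal_subgroup_def green_H_def L R)
  have s: "mult (maximal_subgroup S e) = sprod S" "one (maximal_subgroup S e) = e"
    by (simp_all add: maximal_subgroup_def)
  show ?thesis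
  proof (rule groupI; unfold s)
    fix a b assume ab: "a \<in> carrier (maximal_subgroup S e)" "b \<in> carrier (maximal_subgroup S e)"
    obtain x y x' y' where *: "x \<in> carrier S" "y \<in> carrier S" "x' \<in> carrier S" "y' \<in> carrier S"
      "x \<cdot> a = e" "a \<cdot> x' = e" "y \<cdot> b = e" "b \<cdot> y' = e" using ab H by metis
    have c: "a \<in> carrier S" "b \<in> carrier S" "e \<cdot> a = a" "e \<cdot> b = b" "a \<cdot> e = a" "b \<cdot> e = b"
      using ab H by auto
    have "(y \<cdot> x) \<cdot> (a \<cdot> b) = y \<cdot> ((x \<cdot> a) \<cdot> b)" using c(1,2) *(1-4) by (simp add: sprod_assoc sprod_closed)
    then have 1: "(y \<cdot> x) \<cdot> (a \<cdot> b) = e" using c * by simp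
    have "(a \<cdot> b) \<cdot> (y' \<cdot> x') = a \<cdot> ((b \<cdot> y') \<cdot> x')" using c(1,2) *(1-4) by (simp add: sprod_assoc sprod_closed)
    also have "\<dots> = (a \<cdot> e) \<cdot> x'" using c(1,2) *(1-4) *(8) e by (simp add: sprod_assoc)
    finally have 2: "(a \<cdot> b) \<cdot> (y' \<cdot> x') = e" using c * by simp
    have 3: "e \<cdot> (a \<cdot> b) = a \<cdot> b" using c e by (metis sprod_assoc)
    have 4: "(a \<cdot> b) \<cdot> e = a \<cdot> b" using c e by (metis sprod_assoc)
    show "a \<cdot> b \<in> carrier (maximal_subgroup S e)"
      unfolding H using 1 2 3 4 c * sprod_closed by blast
  next
    show "e \<in> carrier (maximal_subgroup S e)" unfolding H using e by auto
  next
    fix a assume a: "a \<in> carrier (maximal_subgroup S e)"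
    then show "e \<cdot> a = a" using H by auto
    obtain x x' where *: "x \<in> carrier S" "x' \<in> carrier S" "x \<cdot> a = e" "a \<cdot> x' = e" using a H by metis
    have c: "a \<in> carrier S" "e \<cdot> a = a" "a \<cdot> e = a" using a H by auto
    let ?y = "e \<cdot> (x \<cdot> e)"
    have y: "?y \<in> carrier S" using e * sprod_closed by auto
    have xe: "x \<cdot> e = e \<cdot> x'" using * c by (metis sprod_assoc)
    have 1: "?y \<cdot> a = e" using * c e by (metis sprod_assoc sprod_closed)
    have 2: "a \<cdot> ?y = e"
    proof -
      have "a \<cdot> ?y = (a \<cdot> e) \<cdot> (e \<cdot> x')" using * c e xe by (metis sprod_assoc sprod_closed)
      also have "\<dots> = (a \<cdot> e) \<cdot> x'" using * c e by (metis sprod_assoc sprod_closed)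
      finally show ?thesis using * c by simp
    qed
    have 3: "e \<cdot> ?y = ?y" "?y \<cdot> e = ?y" using * e by (metis sprod_assoc sprod_closed)+
    show "\<exists>y\<in>carrier (maximal_subgroup S e). y \<cdot> a = e"
      using 1 2 3 y c by (intro bexI[of _ ?y]) (auto simp: H)
  qed (auto simp: H sprod_assoc)
qed

end

theory Submission
  imports Defs
begin

text \<open>A word \<open>p\<^sub>1\<dots>p\<^sub>k\<close> of successively friendly projections satisfies
  \<open>w w\<^sup>* = p\<^sub>1\<close> and \<open>w\<^sup>* w = p\<^sub>k\<close> in \<open>PG P\<close>. Choosing a tree path \<open>\<tau>\<^sub>p\<close> from \<open>p0\<close> to
  each \<open>p\<close>, the generator \<open>a\<^bsub>p,q\<^esub>\<close> is sent to \<open>\<tau>\<^sub>p \<tau>\<^sub>q\<^sup>*\<close>; tree edges give closed tree walks, which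
  collapse to \<open>p0\<close>, and \<open>u s w = u w\<close> holds in \<open>PG P\<close> for linked triangles \<open>(s, u, w)\<close>. In the
  opposite direction, words over \<open>P\<close> act on the right on pairs \<open>(q, g)\<close> of a vertex and a
  group element by \<open>(q, g) \<cdot> p = (pqp, g a\<^bsub>q,pqp\<^esub>)\<close>, defined if \<open>qpq = q\<close>. The relation
  \<open>x\<^sub>p x\<^sub>q x\<^sub>p = x\<^bsub>pqp\<^esub>\<close> is respected because the square through which both sides move \<open>q\<close> splits into two
  linked triangles. Since \<open>\<tau>\<^sub>q p = (\<tau>\<^sub>q \<tau>\<^sub>r\<^sup>*) \<tau>\<^sub>r\<close> for \<open>r = pqp\<close>, the two maps are mutually
  inverse.\<close>

section \<open>Green's relations in regular star-semigroups\<close>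

lemma (in is_semigroup) left_ideal_subset:
  assumes "x \<in> carrier S" "b \<in> carrier S"
  shows "left_ideal S (x \<cdot> b) \<subseteq> left_ideal S b"
  using assms by (auto simp: left_ideal_def sprod_assoc[symmetric] intro: sprod_closed)

lemma (in is_semigroup) right_ideal_subset:
  assumes "x \<in> carrier S" "b \<in> carrier S"
  shows "right_ideal S (b \<cdot> x) \<subseteq> right_ideal S b"
  using assms by (auto simp: right_ideal_def sprod_assoc intro: sprod_closed)

lemma (in is_semigroup) green_L_I:
  assumes "a \<in> carrier S" "b \<in> carrier S" "x \<in> carrier S" "y \<in> carrier S" "a = x \<cdot> b" "b = y \<cdot> a"
  shows "(a, b) \<in> green_L S"
  using left_ideal_subset[OF assms(3,2), folded assms(5)] left_ideal_subset[OF assms(4,1), folded assms(6)]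
    assms(1,2) unfolding green_L_def by blast

lemma (in is_semigroup) green_R_I:
  assumes "a \<in> carrier S" "b \<in> carrier S" "x \<in> carrier S" "y \<in> carrier S" "a = b \<cdot> x" "b = a \<cdot> y"
  shows "(a, b) \<in> green_R S"
  using right_ideal_subset[OF assms(3,2), folded assms(5)] right_ideal_subset[OF assms(4,1), folded assms(6)]
    assms(1,2) unfolding green_R_def by blast

lemma (in is_semigroup) green_H_idem_iff:
  assumes e: "e \<in> carrier S" "e \<cdot> e = e"
  shows "(e, a) \<in> green_H S \<longleftrightarrow> a \<in> carrier S \<and> a \<cdot> e = a \<and> e \<cdot> a = a \<and>
    (\<exists>x \<in> carrier S. x \<cdot> a = e) \<and> (\<exists>x \<in> carrier S. a \<cdot> x = e)"
    (is "?l \<longleftrightarrow> ?r")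
proof
  assume ?l
  then have a: "a \<in> carrier S" "left_ideal S e = left_ideal S a" "right_ideal S e = right_ideal S a"
    by (auto simp: green_H_def green_L_def green_R_def)
  have "a \<in> left_ideal S e" "e \<in> left_ideal S a" using a(2) by (auto simp: left_ideal_def)
  then have l: "a \<cdot> e = a" "\<exists>x \<in> carrier S. x \<cdot> a = e"
    using a(1) e unfolding left_ideal_def by (auto simp: sprod_assoc) metis
  have "a \<in> right_ideal S e" "e \<in> right_ideal S a" using a(3) by (auto simp: right_ideal_def)
  then have "e \<cdot> a = a" "\<exists>x \<in> carrier S. a \<cdot> x = e"
    using a(1) e unfolding right_ideal_def by (auto simp: sprod_assoc[symmetric]) metis
  then show ?r using a(1) l by blast
next
  assume ?r
  then obtain x y where "a \<in> carrier S" "a \<cdot> e = a" "e \<cdot> a = a"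
    "x \<in> carrier S" "x \<cdot> a = e" "y \<in> carrier S" "a \<cdot> y = e" by blast
  then show ?l
    unfolding green_H_def using e by (intro IntI green_L_I[of e a x a] green_R_I[of e a y a]) simp_all
qed

text \<open>If \<open>a\<close> is in the left ideal of \<open>b\<close>, then \<open>a\<close>
  absorbs \<open>star S b \<cdot> b\<close> on the right, so the projection of \<open>a\<close> lies
  below that of \<open>b\<close>. By symmetry and applying \<open>star\<close>, the two
  coincide.\<close>

lemma (in regular_star_semigroup) green_L_star:
  assumes "(a, b) \<in> green_L S"
  shows "star S a \<cdot> a = star S b \<cdot> b"
proof -
  have main: "star S a \<cdot> a = (star S a \<cdot> a) \<cdot> (star S b \<cdot> b)"
    if "a \<in> carrier S" "b \<in> carrier S" "a \<in> left_ideal S b" for a b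
  proof -
    have "a = a \<cdot> (star S b \<cdot> b)"
      using that star_regular[of b]
      by (auto simp: left_ideal_def sprod_assoc sprod_closed star_closed)
    then show ?thesis using that by (metis sprod_assoc sprod_closed star_closed)
  qed
  have ab: "a \<in> carrier S" "b \<in> carrier S" "a \<in> left_ideal S b" "b \<in> left_ideal S a"
    using assms by (auto simp: green_L_def left_ideal_def)
  have c: "star S a \<cdot> a \<in> carrier S" "star S b \<cdot> b \<in> carrier S"
    "star S (star S a \<cdot> a) = star S a \<cdot> a" "star S (star S b \<cdot> b) = star S b \<cdot> b"
    using ab by (simp_all add: sprod_closed star_closed star_sprod star_star)
  show ?thesis
    using main[OF ab(1,2,3)] main[OF ab(2,1,4)] c by (metis star_sprod)
qed

lemma (in regular_star_semigroup) green_R_star: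
  assumes "(a, b) \<in> green_R S"
  shows "a \<cdot> star S a = b \<cdot> star S b"
proof -
  have main: "a \<cdot> star S a = (b \<cdot> star S b) \<cdot> (a \<cdot> star S a)"
    if "a \<in> carrier S" "b \<in> carrier S" "a \<in> right_ideal S b" for a b
  proof -
    have "a = (b \<cdot> star S b) \<cdot> a"
      using that star_regular[of b]
      by (auto simp: right_ideal_def sprod_assoc[symmetric] sprod_closed star_closed)
    then show ?thesis using that by (metis sprod_assoc sprod_closed star_closed)
  qed
  have ab: "a \<in> carrier S" "b \<in> carrier S" "a \<in> right_ideal S b" "b \<in> right_ideal S a"
    using assms by (auto simp: green_R_def right_ideal_def)
  have c: "a \<cdot> star S a \<in> carrier S" "b \<cdot> star S b \<in> carrier S"
    "star S (a \<cdot> star S a) = a \<cdot> star S a" "star S (b \<cdot> star S b) = b \<cdot> star S b"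
    using ab by (simp_all add: sprod_closed star_closed star_sprod star_star)
  show ?thesis
    using main[OF ab(1,2,3)] main[OF ab(2,1,4)] c by (metis star_sprod)
qed

lemma (in regular_star_semigroup) green_L_star_left:
  assumes "y \<in> carrier S"
  shows "(star S y \<cdot> y, y) \<in> green_L S"
  using assms star_regular[OF assms]
  by (intro green_L_I[of _ _ "star S y" y]) (simp_all add: sprod_assoc sprod_closed star_closed)

lemma (in regular_star_semigroup) green_R_star_right:
  assumes "y \<in> carrier S"
  shows "(y, y \<cdot> star S y) \<in> green_R S"
  using assms star_regular[OF assms]
  by (intro green_R_I[of _ _ y "star S y"]) (simp_all add: sprod_closed star_closed)

text \<open>Any intermediate \<open>y\<close> between \<open>p\<close> and \<open>q\<close> works,
  because \<open>star S y \<cdot> y\<close> depends only on the L-class of \<open>y\<close> and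
  \<open>y \<cdot> star S y\<close> only on its R-class.\<close>

lemma (in regular_star_semigroup) green_D_projections_iff:
  assumes p: "p \<in> projections S" and q: "q \<in> projections S"
  shows "(p, q) \<in> green_D S \<longleftrightarrow> (\<exists>y \<in> carrier S. star S y \<cdot> y = p \<and> y \<cdot> star S y = q)"
proof
  assume "(p, q) \<in> green_D S"
  then obtain y where y: "(p, y) \<in> green_L S" "(y, q) \<in> green_R S" by (auto simp: green_D_def)
  then have "y \<in> carrier S" by (simp add: green_L_def)
  moreover have "star S y \<cdot> y = p" using green_L_star[OF y(1)] p by (simp add: projections_def)
  moreover have "y \<cdot> star S y = q" using green_R_star[OF y(2)] q by (simp add: projections_def)
  ultimately show "\<exists>y \<in> carrier S. star S y \<cdot> y = p \<and> y \<cdot> star S y = q" by blast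
next
  assume "\<exists>y \<in> carrier S. star S y \<cdot> y = p \<and> y \<cdot> star S y = q"
  then show "(p, q) \<in> green_D S"
    unfolding green_D_def using green_L_star_left green_R_star_right by blast
qed

text \<open>If \<open>y\<close> links \<open>p\<close> to \<open>q\<close>, then
  \<open>r \<cdot> y\<close> links \<open>p\<close> to \<open>r\<close>: on one side
  \<open>q \<cdot> r \<cdot> q\<close> collapses to \<open>q\<close>, on the other
  \<open>r \<cdot> q \<cdot> r\<close> to \<open>r\<close>.\<close>

lemma (in regular_star_semigroup) green_D_friendly:
  assumes P: "is_projection_algebra_of P S" and "p \<in> carrier P" "(p, q) \<in> green_D S"
    and f: "(q, r) \<in> friendly P"
  shows "(p, r) \<in> green_D S"
proof -
  have cP: "carrier P = projections S"
    and act: "\<And>p q. p \<in> carrier P \<Longrightarrow> q \<in> carrier P \<Longrightarrow> act P p q = p \<cdot> q \<cdot> p"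
    using P unfolding is_projection_algebra_of_def by blast+
  have qr: "q \<in> carrier P" "r \<in> carrier P" "act P q r = q" "act P r q = r"
    using f unfolding friendly_def by blast+
  have pr: "p \<in> projections S" "q \<in> projections S" "r \<in> projections S"
    using assms(2) qr(1,2) cP by blast+
  have e: "q \<cdot> r \<cdot> q = q" "r \<cdot> q \<cdot> r = r"
    using act qr by metis+
  have c: "q \<in> carrier S" "r \<in> carrier S" "star S r = r" "r \<cdot> r = r" "star S q = q" "q \<cdot> q = q"
    using pr unfolding projections_def by blast+
  obtain y where y: "y \<in> carrier S" "star S y \<cdot> y = p" "y \<cdot> star S y = q"
    using assms(3) pr green_D_projections_iff by blast
  have s: "star S y \<in> carrier S" "star S (r \<cdot> y) = star S y \<cdot> r"
    using y(1) c by (simp_all add: star_closed star_sprod)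
  have qy: "q \<cdot> y = y" using y(3) star_regular[OF y(1)] by simp
  then have yq: "star S y \<cdot> q = star S y" using star_sprod[OF c(1) y(1)] c by simp
  have "star S (r \<cdot> y) \<cdot> (r \<cdot> y) = (star S y \<cdot> q) \<cdot> (r \<cdot> r) \<cdot> (q \<cdot> y)"
    unfolding s(2) yq qy using c(1,2) y(1) s(1) by (simp add: sprod_assoc sprod_closed)
  also have "\<dots> = star S y \<cdot> (q \<cdot> r \<cdot> q) \<cdot> y"
    unfolding c(4) using c(1,2) y(1) s(1) by (simp add: sprod_assoc sprod_closed)
  also have "\<dots> = p" using e yq y by simp
  finally have 1: "star S (r \<cdot> y) \<cdot> (r \<cdot> y) = p" .
  have "(r \<cdot> y) \<cdot> star S (r \<cdot> y) = r \<cdot> (y \<cdot> star S y) \<cdot> r"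
    unfolding s(2) using c(1,2) y(1) s(1) by (simp add: sprod_assoc sprod_closed)
  then have 2: "(r \<cdot> y) \<cdot> star S (r \<cdot> y) = r" using e y by simp
  show ?thesis using green_D_projections_iff pr 1 2 sprod_closed y(1) c(2) by blast
qed

section \<open>Friendly projections and tree walks\<close>

context projection_algebra
begin

text \<open>The condition \<open>act P p q = q\<close> says that \<open>q\<close> is below
  \<open>p\<close> in the natural order of projections. In a star-semigroup it gives
  \<open>qp = q\<close>, so \<open>q\<close> absorbs \<open>p\<close>.\<close>

lemma act_le: "p \<in> carrier P \<Longrightarrow> q \<in> carrier P \<Longrightarrow> act P p q = q \<Longrightarrow> x \<in> carrier P
    \<Longrightarrow> act P q (act P p x) = act P q x"
  by (metis act_act act_idem act_closed)

lemma act_le_antisym: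
  assumes "p \<in> carrier P" "q \<in> carrier P" "act P p q = q" "act P q p = p"
  shows "p = q"
  using act_swap[of p q] assms by (simp add: act_self)

text \<open>Writing \<open>r\<close> as \<open>act P q r\<close> turns the left side into an
  instance of \<open>act_pair_idem\<close>. So each \<open>act P p\<close> preserves the order,
  which \<open>fin_mono\<close> iterates.\<close>

lemma act_mono:
  assumes "p \<in> carrier P" "q \<in> carrier P" "r \<in> carrier P" "act P q r = r"
  shows "act P (act P p q) (act P p r) = act P p r"
  using act_pair_idem[of q p r] act_act[of p q "act P p r"] assms
  by (simp add: act_closed act_idem)

text \<open>The projection \<open>r\<close> is a value of \<open>act P (act P r p)\<close>, hence
  fixed by it, while this operation also sends \<open>r\<close> to \<open>act P r p\<close>.
  Consequently \<open>pqp\<close> can act on \<open>r\<close> only if \<open>p\<close> can.\<close>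

lemma act_eq_left:
  assumes c: "p \<in> carrier P" "q \<in> carrier P" "r \<in> carrier P" and r: "act P r (act P p q) = r"
  shows "act P r p = r"
proof -
  have "act P (act P r p) (act P p q) = r"
    using act_act[of r p "act P p q"] act_pair_idem[of p r q] c r by (simp add: act_closed act_idem)
  then have "act P (act P r p) r = r" using act_idem[of "act P r p" "act P p q"] c by (simp add: act_closed)
  moreover have "act P (act P r p) r = act P r p"
    using act_act[of r p r] c by (simp add: act_self act_swap)
  ultimately show ?thesis by simp
qed

text \<open>The source of the moves of the action: a letter that can act on \<open>r\<close> moves
  it along a friendly pair.\<close>

lemma friendly_act:
  assumes "p \<in> carrier P" "r \<in> carrier P" "act P r p = r"
  shows "(r, act P p r) \<in> friendly P"
  using assms act_act[of p r r]
  by (simp add: friendly_def act_closed act_swap)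

text \<open>As \<open>s\<close> is below \<open>p\<close>,
  \<open>s(qpq)s = s(pqp)s = sqs = s\<close>; applying \<open>act P q\<close> gives the
  claim.\<close>

lemma act_act_fix:
  assumes c: "p \<in> carrier P" "q \<in> carrier P" "s \<in> carrier P" and s: "act P p s = s" "act P s q = s"
  shows "act P (act P q s) p = act P q s"
proof -
  have "act P s (act P q p) = s"
    using act_le[of p s "act P q p"] act_le[of p s q] c s by (simp add: act_closed act_swap)
  then show ?thesis using act_act[of q s p] c by simp
qed

end


text \<open>The semigroup \<open>S\<close> is replaced by a vertex set \<open>V\<close> closed under
  friendliness, later instantiated by the projections of the D-class of \<open>p0\<close>.\<close>

locale friendly_component = projection_algebra P
  for P :: "('a, 'm) proj_algebra_scheme" +
  fixes V :: "'a set" and p0 :: 'a and T :: "('a \<times> 'a) set"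
  assumes V_sub: "V \<subseteq> carrier P"
    and V_friendly: "q \<in> V \<Longrightarrow> (q, r) \<in> friendly P \<Longrightarrow> r \<in> V"
    and tree: "rooted_spanning_tree V (friendly_on P V) p0 T"
begin

abbreviation F :: "('a \<times> 'a) set" where "F \<equiv> friendly_on P V"

abbreviation W :: "'a list set" where "W \<equiv> semigroup_words (carrier P)"

abbreviation sim :: "'a list \<Rightarrow> 'a list \<Rightarrow> bool" (infix "\<approx>" 50) where
  "u \<approx> v \<equiv> (u, v) \<in> word_cong W (PG_rels P)"

abbreviation GW :: "(('a \<times> 'a) \<times> bool) list set" where "GW \<equiv> group_words F"

abbreviation G_rels where "G_rels \<equiv> cancellations F \<union> subgroup_rels P V T"

abbreviation gsim (infix "\<sim>" 50) where "u \<sim> v \<equiv> (u, v) \<in> word_cong GW G_rels"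

lemma W_iff: "xs \<in> W \<longleftrightarrow> xs \<noteq> [] \<and> set xs \<subseteq> carrier P"
  by (auto simp: semigroup_words_def)

lemma W_append: "u \<in> W \<Longrightarrow> v \<in> W \<Longrightarrow> u @ v \<in> W"
  by (simp add: W_iff)

lemma GW_append: "u \<in> GW \<Longrightarrow> v \<in> GW \<Longrightarrow> u @ v \<in> GW"
  by (simp add: group_words_def)

lemma GW_simps [simp]: "[] \<in> GW" "x # g \<in> GW \<longleftrightarrow> fst x \<in> F \<and> g \<in> GW"
  by (auto simp: group_words_def mem_Times_iff)

lemma sim_in: "u \<approx> v \<Longrightarrow> u \<in> W \<and> v \<in> W"
  using word_cong_in[of W] W_append by blast

lemma gsim_in: "u \<sim> v \<Longrightarrow> u \<in> GW \<and> v \<in> GW"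
  using word_cong_in[of GW] GW_append by blast

lemma sim_trans [trans]: "u \<approx> v \<Longrightarrow> v \<approx> w \<Longrightarrow> u \<approx> w" by (rule word_cong.trans)

lemma gsim_trans [trans]: "u \<sim> v \<Longrightarrow> v \<sim> w \<Longrightarrow> u \<sim> w" by (rule word_cong.trans)

text \<open>The contexts may be empty although \<open>W\<close> lacks the empty word, hence the case
  distinctions.\<close>

lemma sim_context:
  assumes "u \<approx> v" "set a \<subseteq> carrier P" "set b \<subseteq> carrier P"
  shows "a @ u @ b \<approx> a @ v @ b"
proof -
  have 1: "u @ b \<approx> v @ b"
    using assms by (cases "b = []") (auto intro!: word_cong.append word_cong.refl simp: W_iff)
  show ?thesis
    using 1 assms by (cases "a = []") (auto intro!: word_cong.append[OF _ 1] word_cong.refl simp: W_iff)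
qed

lemma gsim_context: "u \<sim> v \<Longrightarrow> a \<in> GW \<Longrightarrow> b \<in> GW \<Longrightarrow> a @ u @ b \<sim> a @ v @ b"
  by (intro word_cong.append word_cong.refl)

lemma gsim_append: "u \<sim> v \<Longrightarrow> u' \<sim> v' \<Longrightarrow> u @ u' \<sim> v @ v'"
  by (rule word_cong.append)

lemma F_iff: "(p, q) \<in> F \<longleftrightarrow> p \<in> V \<and> q \<in> V \<and> act P p q = p \<and> act P q p = q"
  using V_sub by (auto simp: friendly_on_def friendly_def)

lemma F_refl: "p \<in> V \<Longrightarrow> (p, p) \<in> F" and F_sym: "(p, q) \<in> F \<Longrightarrow> (q, p) \<in> F"
  using V_sub by (auto simp: F_iff act_self)

lemma F_act: "r \<in> V \<Longrightarrow> p \<in> carrier P \<Longrightarrow> act P r p = r \<Longrightarrow> (r, act P p r) \<in> F"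
  using friendly_act[of p r] V_friendly[of r "act P p r"] V_sub by (auto simp: friendly_on_def)

lemma T_F: "T \<subseteq> F" and p0_V: "p0 \<in> V"
  using tree by (auto simp: rooted_spanning_tree_def)

section \<open>Relations of \<open>PG P\<close> between friendly projections\<close>

lemma sim_idem: "p \<in> carrier P \<Longrightarrow> [p, p] \<approx> [p]"
  by (rule word_cong.base) (auto simp: PG_rels_def W_iff)

lemma sim_pair: "p \<in> carrier P \<Longrightarrow> q \<in> carrier P \<Longrightarrow> [p, q, p, q] \<approx> [p, q]"
  by (rule word_cong.base) (auto simp: PG_rels_def W_iff)

lemma sim_act: "p \<in> carrier P \<Longrightarrow> q \<in> carrier P \<Longrightarrow> [p, q, p] \<approx> [act P p q]"
  by (rule word_cong.base) (auto simp: PG_rels_def W_iff act_closed)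

lemma sim_F: "(p, q) \<in> F \<Longrightarrow> [p, q, p] \<approx> [p]"
  using sim_act[of p q] V_sub by (auto simp: F_iff)

text \<open>After \<open>q\<close>, the letter \<open>p\<close> can be traded for the vertex to
  which it moves \<open>q\<close>; this ties words to the action defined below.\<close>

lemma sim_step:
  assumes "q \<in> carrier P" "p \<in> carrier P"
  shows "[q, p] \<approx> [q, act P p q]"
proof -
  have "[q, p] \<approx> [q, p, q, p]" by (rule word_cong.sym[OF sim_pair[OF assms]])
  also have "[q, p, q, p] \<approx> [q, act P p q]"
    using sim_context[OF sim_act[OF assms(2,1)], of "[q]" "[]"] assms by simp
  finally show ?thesis .
qed

text \<open>With the linking projection \<open>p\<close>, \<open>sw = s(pup) = sup\<close> because
  \<open>s\<close> absorbs \<open>p\<close>. Then \<open>usup = up\<close> by friendliness, and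
  \<open>up = uw\<close> by \<open>sim_step\<close>.\<close>

lemma sim_triangle:
  assumes "linked_triangle P V s u w"
  shows "[u, s, w] \<approx> [u, w]"
proof -
  obtain p where p: "p \<in> carrier P" "act P p s = s" "act P p u = w" and us: "(u, s) \<in> F"
    and c: "s \<in> carrier P" "u \<in> carrier P"
    using assms V_sub by (auto simp: linked_triangle_def)
  have uw: "[u, p] \<approx> [u, w]" using sim_step[of u p] p c by simp
  have s: "[s] \<approx> [p, s, p]" using sim_act[of p s] p c by (simp add: word_cong.sym)
  have sp: "[s, p] \<approx> [s]"
  proof -
    have "[s, p] \<approx> [p, s, p, p]" using sim_context[OF s, of "[]" "[p]"] p by simp
    also have "[p, s, p, p] \<approx> [p, s, p]" using sim_context[OF sim_idem[of p], of "[p, s]" "[]"] p c by simp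
    also have "[p, s, p] \<approx> [s]" using s by (rule word_cong.sym)
    finally show ?thesis .
  qed
  have sw: "[s, w] \<approx> [s, u, p]"
  proof -
    have "[s, w] \<approx> [s, p, u, p]"
      using sim_context[OF word_cong.sym[OF sim_act[of p u]], of "[s]" "[]"] p c by simp
    also have "[s, p, u, p] \<approx> [s, u, p]" using sim_context[OF sp, of "[]" "[u, p]"] p c by simp
    finally show ?thesis .
  qed
  have "[u, s, w] \<approx> [u, s, u, p]" using sim_context[OF sw, of "[u]" "[]"] c by simp
  also have "[u, s, u, p] \<approx> [u, p]" using sim_context[OF sim_F[OF us], of "[]" "[p]"] p by simp
  also note uw
  finally show ?thesis .
qed

section \<open>Paths in the friendliness digraph\<close>

abbreviation path :: "'a list \<Rightarrow> bool" where
  "path xs \<equiv> xs \<noteq> [] \<and> set xs \<subseteq> V \<and> successively (\<lambda>p q. (p, q) \<in> F) xs"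

lemma path_rev: "path xs \<Longrightarrow> path (rev xs)"
  using F_sym by (auto simp: successively_rev intro: successively_mono)

lemma path_append: "path xs \<Longrightarrow> path ys \<Longrightarrow> (last xs, hd ys) \<in> F \<Longrightarrow> path (xs @ ys)"
  by (simp add: successively_append_iff)

text \<open>The word folds from its middle: the tail with its reversal reduces to \<open>y\<close>,
  and \<open>xyx\<close> reduces to \<open>x\<close> by friendliness. Reversal thus acts as the star
  operation.\<close>

lemma path_rev_sim: "path xs \<Longrightarrow> xs @ rev xs \<approx> [hd xs]"
proof (induction xs rule: induct_list012)
  case (2 x)
  then show ?case using sim_idem[of x] V_sub by auto
next
  case (3 x y zs)
  have c: "x \<in> carrier P" using 3 V_sub by auto
  have "[x] @ ((y # zs) @ rev (y # zs)) @ [x] \<approx> [x] @ [y] @ [x]"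
    by (rule sim_context) (use 3 c in auto)
  also have "[x] @ [y] @ [x] \<approx> [x]" using sim_F[of x y] 3 by simp
  finally show ?case by simp
qed simp

lemma rev_path_sim: "path xs \<Longrightarrow> rev xs @ xs \<approx> [last xs]"
  using path_rev_sim[of "rev xs"] path_rev by (simp add: hd_rev)

lemma path_hd_absorb: "path xs \<Longrightarrow> [hd xs] @ xs \<approx> xs"
  using sim_context[OF sim_idem[of "hd xs"], of "[]" "tl xs"] V_sub
  by (cases xs) auto

lemma path_last_absorb: "path xs \<Longrightarrow> xs @ [last xs] \<approx> xs"
  using sim_context[OF sim_idem[of "last xs"], of "butlast xs" "[]"] V_sub
  by (cases xs rule: rev_cases) auto

section \<open>Walks in the spanning tree, with orientation forgotten\<close>

definition adj :: "'a \<Rightarrow> 'a \<Rightarrow> bool" where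
  "adj p q \<longleftrightarrow> (p, q) \<in> T \<or> (q, p) \<in> T"

lemma adj_F: "adj p q \<Longrightarrow> (p, q) \<in> F"
  using T_F F_sym by (auto simp: adj_def)

lemma adj_edge: "adj p q \<Longrightarrow> {p, q} \<in> {{p, q} | p q. (p, q) \<in> T}"
  unfolding adj_def by blast

lemma adj_irrefl: "\<not> adj p p"
proof
  assume "adj p p"
  then have "{p, p} \<in> {{u, v} | u v. u \<in> V \<and> v \<in> V \<and> u \<noteq> v}"
    using tree adj_edge[of p p] unfolding rooted_spanning_tree_def undirected_tree_def by blast
  then show False by (auto simp: doubleton_eq_iff)
qed

text \<open>The appended \<open>hd xs\<close> encodes the closing edge that the tree condition
  expresses modulo the length. Length two remains possible: it is a step forth and back along one
  edge.\<close>

lemma adj_no_cycle: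
  assumes "successively adj (xs @ [hd xs])" "distinct xs"
  shows "length xs < 3"
proof (rule ccontr)
  assume l: "\<not> length xs < 3"
  have "adj (xs ! i) (xs ! (Suc i mod length xs))" if "i < length xs" for i
  proof (cases "Suc i < length xs")
    case True
    then show ?thesis
      using successively_nth[OF assms(1), of i] by (simp add: nth_append)
  next
    case False
    then have "Suc i = length xs" using that by simp
    moreover from this have "adj (xs ! i) (hd xs)"
      using successively_nth[OF assms(1), of i] by (simp add: nth_append)
    ultimately show ?thesis using that by (cases xs) auto
  qed
  then have "\<forall>i < length xs. {xs ! i, xs ! (Suc i mod length xs)} \<in> {{p, q} | p q. (p, q) \<in> T}"
    using adj_edge by blast
  then show False
    using tree assms(2) l unfolding rooted_spanning_tree_def undirected_tree_def
    by (meson not_less)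
qed

abbreviation walk :: "'a list \<Rightarrow> bool" where
  "walk xs \<equiv> xs \<noteq> [] \<and> set xs \<subseteq> V \<and> successively adj xs"

lemma walk_path: "walk xs \<Longrightarrow> path xs"
  using adj_F by (auto intro: successively_mono)

lemma walk_rev: "walk xs \<Longrightarrow> walk (rev xs)"
  by (auto simp: adj_def intro: successively_mono)

text \<open>Prepending \<open>x\<close> to a reduced walk that meets \<open>x\<close> again closes a cycle unless it backtracks
  immediately.\<close>

lemma walk_reduce:
  "walk xs \<Longrightarrow> \<exists>ys. walk ys \<and> distinct ys \<and> hd ys = hd xs \<and> last ys = last xs \<and> xs \<approx> ys"
proof (induction xs rule: induct_list012)
  case (2 x)
  then show ?case using V_sub by (intro exI[of _ "[x]"]) (auto intro!: word_cong.refl simp: W_iff)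
next
  case (3 x y zs)
  then obtain ys where ys: "walk ys" "distinct ys" "hd ys = y" "last ys = last (y # zs)" "y # zs \<approx> ys"
    by auto
  have x: "x \<in> V" "adj x y" "x \<in> carrier P" using 3 V_sub by auto
  have sim: "x # y # zs \<approx> x # ys" using sim_context[OF ys(5), of "[x]" "[]"] x by simp
  show ?case
  proof (cases "x \<in> set ys")
    case False
    then show ?thesis using ys x sim by (intro exI[of _ "x # ys"]) (auto simp: successively_Cons)
  next
    case True
    then obtain as bs where ab: "ys = as @ x # bs" by (meson split_list)
    have "successively adj ((x # as) @ [hd (x # as)])" "distinct (x # as)"
      using ys ab x adj_irrefl by (auto simp: successively_append_iff successively_Cons hd_append split: if_splits)
    then have "length (x # as) < 3" by (rule adj_no_cycle)
    moreover have "as \<noteq> []" using ab ys(3) x adj_irrefl by auto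
    ultimately have "as = [y]" using ab ys(3) by (cases as; cases "tl as") auto
    then have "x # ys \<approx> x # bs"
      using sim_context[OF sim_F[OF adj_F[OF x(2)]], of "[]" bs] ab ys(1) V_sub by auto
    with sim have "x # y # zs \<approx> x # bs" by (rule word_cong.trans)
    then show ?thesis using ys ab x
      by (intro exI[of _ "x # bs"]) (auto simp: successively_append_iff)
  qed
qed simp

text \<open>A walk with distinct vertices and equal ends is a single vertex. This yields the tree
  relations in \<open>blk_adj\<close> and collapses \<open>tau p0\<close>.\<close>

lemma closed_walk_sim: "walk xs \<Longrightarrow> hd xs = last xs \<Longrightarrow> xs \<approx> [hd xs]"
proof -
  assume xs: "walk xs" "hd xs = last xs"
  then obtain ys where ys: "walk ys" "distinct ys" "hd ys = hd xs" "last ys = last xs" "xs \<approx> ys"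
    using walk_reduce by blast
  then have "ys = [hd xs]" using xs(2) by (cases ys) (auto split: if_splits dest: last_in_set)
  then show ?thesis using ys by simp
qed

lemma ex_walk:
  assumes "q \<in> V"
  shows "\<exists>xs. walk xs \<and> hd xs = p0 \<and> last xs = q"
proof -
  have "(p0, q) \<in> T\<^sup>*" using tree assms by (simp add: rooted_spanning_tree_def)
  then show ?thesis
  proof induction
    case base
    then show ?case using p0_V by (intro exI[of _ "[p0]"]) auto
  next
    case (step q r)
    then obtain xs where "walk xs" "hd xs = p0" "last xs = q" by blast
    moreover have "adj q r" "r \<in> V" using step(2) T_F F_iff by (auto simp: adj_def)
    ultimately show ?case by (intro exI[of _ "xs @ [r]"]) (auto simp: successively_append_iff)
  qed
qed

definition tau :: "'a \<Rightarrow> 'a list" where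
  "tau q = (SOME xs. walk xs \<and> hd xs = p0 \<and> last xs = q)"

lemma tau: "q \<in> V \<Longrightarrow> walk (tau q)" "q \<in> V \<Longrightarrow> hd (tau q) = p0" "q \<in> V \<Longrightarrow> last (tau q) = q"
  unfolding tau_def using someI_ex[OF ex_walk, of q] by blast+

lemma tau_path: "q \<in> V \<Longrightarrow> path (tau q)"
  using tau(1) walk_path by blast

section \<open>Consequences of the group relations\<close>

lemma g_refl: "p \<in> V \<Longrightarrow> [gen p p] \<sim> []"
  by (rule word_cong.base) (auto simp: subgroup_rels_def F_refl)

lemma g_inv: "(p, q) \<in> F \<Longrightarrow> [gen p q] \<sim> [gen_inv q p]"
  by (rule word_cong.base) (auto simp: subgroup_rels_def F_sym)

lemma g_cancel: "(p, q) \<in> F \<Longrightarrow> [((p, q), b), ((p, q), \<not> b)] \<sim> []"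
  by (rule word_cong.base) (auto simp: cancellations_def)

lemma g_back: "(p, q) \<in> F \<Longrightarrow> [gen p q, gen q p] \<sim> []"
  using gsim_append[OF word_cong.refl[of "[gen p q]"] g_inv[OF F_sym, of p q]] g_cancel[of p q True]
  by (auto intro: word_cong.trans)

text \<open>A relation trivialises the orientation contained in \<open>T\<close>; the opposite one
  follows by \<open>g_back\<close>.\<close>

lemma g_adj:
  assumes "adj p q"
  shows "[gen p q] \<sim> []"
proof -
  have T: "[gen p q] \<sim> []" if "(p, q) \<in> T" for p q
    using that T_F by (intro word_cong.base) (auto simp: subgroup_rels_def)
  show ?thesis
  proof (cases "(p, q) \<in> T")
    case False
    then have "(q, p) \<in> T" using assms by (simp add: adj_def)
    then have "[gen p q] @ [gen q p] \<sim> [gen p q] @ []"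
      using T adj_F[OF assms] by (intro gsim_append word_cong.refl) auto
    then show ?thesis
      using g_back[OF adj_F[OF assms]] by (auto intro: word_cong.trans word_cong.sym)
  qed (rule T)
qed

lemma g_triangle: "linked_triangle P V s u w \<Longrightarrow> [gen u s, gen s w] \<sim> [gen u w]"
  by (rule word_cong.base) (auto simp: subgroup_rels_def linked_triangle_def)

subsection \<open>The action of words on labelled vertices\<close>

text \<open>The right action of words on \<open>V\<close>, modelled on the right multiplication action of
  \<open>PG P\<close> on the \<open>\<R>\<close>-class of \<open>x\<^bsub>p0\<^esub>\<close>: the letter \<open>p\<close> moves \<open>q\<close> to \<open>act P p q\<close> and is
  defined on \<open>q\<close> only if \<open>q\<close> and \<open>act P p q\<close> are friendly; \<open>lab\<close> records the
  generators of the traversed edges.\<close>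

primrec ok :: "'a \<Rightarrow> 'a list \<Rightarrow> bool" where
  "ok q [] \<longleftrightarrow> True"
| "ok q (p # w) \<longleftrightarrow> act P q p = q \<and> ok (act P p q) w"

primrec fin :: "'a \<Rightarrow> 'a list \<Rightarrow> 'a" where
  "fin q [] = q"
| "fin q (p # w) = fin (act P p q) w"

primrec lab :: "'a \<Rightarrow> 'a list \<Rightarrow> (('a \<times> 'a) \<times> bool) list" where
  "lab q [] = []"
| "lab q (p # w) = gen q (act P p q) # lab (act P p q) w"

lemma run_append [simp]:
  "ok q (u @ v) \<longleftrightarrow> ok q u \<and> ok (fin q u) v"
  "fin q (u @ v) = fin (fin q u) v"
  "lab q (u @ v) = lab q u @ lab (fin q u) v"
  by (induction u arbitrary: q) auto

lemma run_closed:
  "q \<in> V \<Longrightarrow> set u \<subseteq> carrier P \<Longrightarrow> ok q u \<Longrightarrow> fin q u \<in> V \<and> lab q u \<in> GW"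
proof (induction u arbitrary: q)
  case (Cons p u)
  then have "(q, act P p q) \<in> F" using F_act by auto
  moreover from this have "act P p q \<in> V" by (simp add: F_iff)
  ultimately show ?case using Cons by auto
qed simp

lemma fin_in: "q \<in> carrier P \<Longrightarrow> set u \<subseteq> carrier P \<Longrightarrow> fin q u \<in> carrier P"
  by (induction u arbitrary: q) (auto simp: act_closed)

lemma fin_mono:
  "q \<in> carrier P \<Longrightarrow> r \<in> carrier P \<Longrightarrow> act P q r = r \<Longrightarrow> set u \<subseteq> carrier P
    \<Longrightarrow> act P (fin q u) (fin r u) = fin r u"
  by (induction u arbitrary: q r) (auto simp: act_closed act_mono)

text \<open>After the letter \<open>p\<close> the current vertex lies below \<open>p\<close>, so a
  repeated \<open>p\<close> acts and stays in place.\<close>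

lemma act_step:
  assumes "r \<in> V" "p \<in> carrier P" "act P r p = r"
  shows "act P p r \<in> V" "act P (act P p r) p = act P p r" "act P p (act P p r) = act P p r"
  using F_act[OF assms] assms V_sub act_act[of p r p]
  by (auto simp: F_iff act_self act_swap act_idem)

text \<open>From \<open>s\<close> below \<open>p\<close>, the letters \<open>q\<close>,
  \<open>p\<close>, \<open>q\<close> lead to \<open>t = qsq\<close>, on to \<open>ptp\<close> and
  back to \<open>t\<close>. The second use of \<open>act_act_fix\<close> exchanges \<open>p\<close>
  and \<open>q\<close>.\<close>

lemma act_step_pair:
  assumes "p \<in> carrier P" "q \<in> carrier P" "s \<in> carrier P" "act P p s = s" "act P s q = s"
  shows "act P (act P q s) p = act P q s"
    "act P (act P p (act P q s)) q = act P p (act P q s)"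
    "act P q (act P p (act P q s)) = act P q s"
  using act_act_fix[OF assms] act_act_fix[of q p "act P q s"] act_pair_idem[of p q s] assms
  by (simp_all add: act_closed act_idem)

text \<open>Quantifying over all start vertices, not just \<open>p0\<close>, makes the relation
  compatible with concatenation.\<close>

definition agree :: "'a list \<Rightarrow> 'a list \<Rightarrow> bool" where
  "agree u v \<longleftrightarrow> (\<forall>q \<in> V. (ok q u \<longleftrightarrow> ok q v) \<and> (ok q u \<longrightarrow> fin q u = fin q v \<and> lab q u \<sim> lab q v))"

lemma agree_idem:
  assumes "p \<in> carrier P"
  shows "agree [p, p] [p]"
  unfolding agree_def
proof (intro ballI)
  fix r assume r: "r \<in> V"
  show "(ok r [p, p] \<longleftrightarrow> ok r [p]) \<and> (ok r [p, p] \<longrightarrow> fin r [p, p] = fin r [p] \<and> lab r [p, p] \<sim> lab r [p])"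
  proof (cases "act P r p = r")
    case True
    note s = act_step[OF r assms True]
    have "[gen r (act P p r)] @ [gen (act P p r) (act P p r)] \<sim> [gen r (act P p r)] @ []"
      using F_act[OF r assms True] s by (intro gsim_append word_cong.refl g_refl) auto
    then show ?thesis using True s by simp
  qed simp
qed

lemma agree_pair:
  assumes p: "p \<in> carrier P" and q: "q \<in> carrier P"
  shows "agree [p, q, p, q] [p, q]"
  unfolding agree_def
proof (intro ballI)
  fix r assume r: "r \<in> V"
  define s where "s = act P p r"
  define t where "t = act P q s"
  define v where "v = act P p t"
  show "(ok r [p, q, p, q] \<longleftrightarrow> ok r [p, q]) \<and>
    (ok r [p, q, p, q] \<longrightarrow> fin r [p, q, p, q] = fin r [p, q] \<and> lab r [p, q, p, q] \<sim> lab r [p, q])"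
  proof (cases "act P r p = r \<and> act P s q = s")
    case True
    have s: "s \<in> V" "act P p s = s" using act_step[OF r p] True by (simp_all add: s_def)
    have t: "t \<in> V" using act_step[OF s(1) q] True by (simp add: t_def)
    have tv: "act P t p = t" "act P v q = v" "act P q v = t"
      using act_step_pair[of p q s] p q s V_sub True by (auto simp: t_def v_def)
    have F: "(r, s) \<in> F" "(s, t) \<in> F" "(t, v) \<in> F"
      using F_act[OF r p] F_act[OF s(1) q] F_act[OF t p] True tv by (simp_all add: s_def t_def v_def)
    \<comment> \<open>The repeated \<open>pq\<close> only runs from \<open>t\<close> to
      \<open>v\<close> and back.\<close>
    have "[gen r s, gen s t] @ [gen t v, gen v t] \<sim> [gen r s, gen s t] @ []"
      using F by (intro gsim_append word_cong.refl g_back) auto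
    then show ?thesis
      using True tv by (simp flip: s_def t_def v_def)
  qed (auto simp: s_def)
qed

lemma agree_act:
  assumes p: "p \<in> carrier P" and q: "q \<in> carrier P"
  shows "agree [p, q, p] [act P p q]"
  unfolding agree_def
proof (intro ballI)
  fix r assume r: "r \<in> V"
  have rc: "r \<in> carrier P" using r V_sub by auto
  define s where "s = act P p r"
  define t where "t = act P q s"
  define v where "v = act P p t"
  have v: "act P (act P p q) r = v"
    using act_act[of p q r] p q rc by (simp add: s_def t_def v_def)
  show "(ok r [p, q, p] \<longleftrightarrow> ok r [act P p q]) \<and>
    (ok r [p, q, p] \<longrightarrow> fin r [p, q, p] = fin r [act P p q] \<and> lab r [p, q, p] \<sim> lab r [act P p q])"
  proof (cases "act P r p = r \<and> act P s q = s")
    case True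
    have s: "s \<in> V" "act P p s = s" using act_step[OF r p] True by (simp_all add: s_def)
    have sc: "s \<in> carrier P" using s V_sub by auto
    have t: "t \<in> V" using act_step[OF s(1) q] True by (simp add: t_def)
    have tp: "act P t p = t"
      using act_step_pair[of p q s] p q sc s True by (simp add: t_def)
    have "act P r s = r" using act_swap[OF rc p] True by (simp add: s_def)
    \<comment> \<open>Since \<open>act P r p = r\<close>, \<open>act_act\<close> turns
      \<open>act P r (act P p q)\<close> into \<open>act P r\<close> applied to this value
      \<open>s\<close>, which is \<open>r\<close>.\<close>
    moreover have "act P p (act P r (act P p q)) = s"
      using act_act[of p r q] p q rc True by (simp add: s_def)
    ultimately have rpq: "act P r (act P p q) = r"
      using act_act[of r p "act P p q"] act_closed[OF p q] p rc True by simp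
    have F: "(r, s) \<in> F" "(s, t) \<in> F" "(t, v) \<in> F" "(r, v) \<in> F"
      using F_act[OF r p] F_act[OF s(1) q] F_act[OF t p] F_act[OF r act_closed[OF p q]] True tp rpq v
      by (simp_all add: s_def t_def v_def)
    have "act P s (act P p q) = s"
      using act_le[of p s q] p q sc s True by simp
    moreover have "act P (act P p q) s = v"
      using act_act[of p q s] p q sc s by (simp add: t_def v_def)
    ultimately have sv: "(s, v) \<in> F"
      using F_act[OF s(1) act_closed[OF p q]] by simp
    have V: "v \<in> V" using F by (simp add: F_iff)
    have pv: "act P p v = v" using act_idem[of p t] p t V_sub by (auto simp: v_def)
    \<comment> \<open>The diagonal between \<open>s\<close> and \<open>v\<close> cuts the square.
      Both triangles are linked by \<open>p\<close>, which fixes \<open>s\<close> and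
      \<open>v\<close>, sends \<open>t\<close> to \<open>v\<close> and \<open>r\<close> to
      \<open>s\<close>.\<close>
    have tri: "linked_triangle P V s t v" "linked_triangle P V v r s"
      using F sv F_sym s t r V p pv v_def s_def unfolding linked_triangle_def by blast+
    note tri = g_triangle[OF tri(1)] g_triangle[OF tri(2)]
    \<comment> \<open>The first edge is rerouted via \<open>v\<close> and the third via
      \<open>s\<close>; then the detours \<open>s, t, s\<close> and \<open>v, s, v\<close>
      cancel.\<close>
    have "[gen r s, gen s t, gen t v] \<sim> [gen r v, gen v s, gen s t, gen t v]"
      using gsim_context[OF word_cong.sym[OF tri(2)], of "[]" "[gen s t, gen t v]"] F by simp
    also have "[gen r v, gen v s, gen s t, gen t v] \<sim> [gen r v, gen v s, gen s t, gen t s, gen s v]"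
      using gsim_context[OF word_cong.sym[OF tri(1)], of "[gen r v, gen v s, gen s t]" "[]"] F F_sym sv
      by simp
    also have "[gen r v, gen v s, gen s t, gen t s, gen s v] \<sim> [gen r v, gen v s, gen s v]"
      using gsim_context[OF g_back[OF F(2)], of "[gen r v, gen v s]" "[gen s v]"] F F_sym sv by simp
    also have "[gen r v, gen v s, gen s v] \<sim> [gen r v]"
      using gsim_context[OF g_back[OF F_sym[OF sv]], of "[gen r v]" "[]"] F by simp
    finally show ?thesis
      using True tp rpq v by (simp flip: s_def t_def v_def)
  next
    case False
    have "act P r (act P p q) \<noteq> r"
    proof
      assume a: "act P r (act P p q) = r"
      have 1: "act P r p = r" by (rule act_eq_left[OF p q rc a])
      moreover have "act P s q = s"
        using act_act[of p r q] a p q rc by (simp add: s_def)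
      ultimately show False using False by blast
    qed
    then show ?thesis using False by (auto simp: s_def)
  qed
qed

text \<open>Makes the partial action of words one of \<open>PG P\<close>, with labels well defined
  in the presented group.\<close>

lemma sim_agree: "u \<approx> v \<Longrightarrow> agree u v"
proof (induction rule: word_cong.induct)
  case (base u v)
  then show ?case using agree_idem agree_pair agree_act by (auto simp: PG_rels_def)
next
  case (refl u)
  then show ?case
    unfolding agree_def using run_closed by (auto intro!: word_cong.refl simp: W_iff)
next
  case (sym u v)
  then show ?case unfolding agree_def by (auto intro: word_cong.sym)
next
  case (trans u v w)
  then show ?case unfolding agree_def by (metis word_cong.trans)
next
  case (append u v u' v')
  have u: "set u \<subseteq> carrier P" using sim_in[OF append(1)] by (auto simp: W_iff)
  show ?case
    unfolding agree_def
  proof (intro ballI)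
    fix q assume q: "q \<in> V"
    have 1: "ok q u \<longleftrightarrow> ok q v" "ok q u \<Longrightarrow> fin q u = fin q v" "ok q u \<Longrightarrow> lab q u \<sim> lab q v"
      using append(3) q unfolding agree_def by blast+
    have "fin q u \<in> V" if "ok q u" using run_closed[OF q u that] by blast
    then have 2: "ok (fin q u) u' \<longleftrightarrow> ok (fin q u) v'"
      "ok (fin q u) u' \<Longrightarrow> fin (fin q u) u' = fin (fin q u) v'"
      "ok (fin q u) u' \<Longrightarrow> lab (fin q u) u' \<sim> lab (fin q u) v'" if "ok q u"
      using that append(4) unfolding agree_def by blast+
    show "(ok q (u @ u') \<longleftrightarrow> ok q (v @ v')) \<and>
      (ok q (u @ u') \<longrightarrow> fin q (u @ u') = fin q (v @ v') \<and> lab q (u @ u') \<sim> lab q (v @ v'))"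
    proof (cases "ok q u")
      case True
      then show ?thesis using 1 2 gsim_append by simp
    qed (use 1 in simp)
  qed
qed

subsection \<open>Words representing the generators\<close>

definition blk :: "'a \<Rightarrow> 'a \<Rightarrow> 'a list" where
  "blk p q = tau p @ rev (tau q)"

fun letter :: "('a \<times> 'a) \<times> bool \<Rightarrow> 'a list" where
  "letter ((p, q), b) = (if b then blk p q else blk q p)"

text \<open>The final \<open>[p0]\<close> represents the group identity and keeps the image
  nonempty, as \<open>W\<close> demands.\<close>

primrec psi :: "(('a \<times> 'a) \<times> bool) list \<Rightarrow> 'a list" where
  "psi [] = [p0]"
| "psi (x # g) = letter x @ psi g"

lemma blk_path:
  assumes "(p, q) \<in> F"
  shows "path (blk p q)" "hd (blk p q) = p0" "last (blk p q) = p0"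
proof -
  have V: "p \<in> V" "q \<in> V" using assms by (auto simp: F_iff)
  show "path (blk p q)"
    unfolding blk_def
    using tau_path tau(3) V assms by (intro path_append path_rev) (auto simp: hd_rev)
  show "hd (blk p q) = p0" "last (blk p q) = p0"
    using tau V by (auto simp: blk_def last_rev hd_append)
qed

lemma letter_path:
  "fst x \<in> F \<Longrightarrow> path (letter x)" "fst x \<in> F \<Longrightarrow> hd (letter x) = p0" "fst x \<in> F \<Longrightarrow> last (letter x) = p0"
  using blk_path F_sym by (cases x rule: letter.cases; auto)+

lemma psi_path:
  "g \<in> GW \<Longrightarrow> path (psi g) \<and> hd (psi g) = p0 \<and> last (psi g) = p0"
proof (induction g)
  case (Cons x g)
  then have x: "fst x \<in> F" and g: "path (psi g)" "hd (psi g) = p0" "last (psi g) = p0" by auto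
  have "path (letter x @ psi g)"
    using letter_path[OF x] g F_refl[OF p0_V] by (intro path_append) auto
  then show ?case using letter_path[OF x] g by simp
qed (use p0_V in simp)

lemma path_carrier: "path xs \<Longrightarrow> xs \<in> W" "path xs \<Longrightarrow> set xs \<subseteq> carrier P"
  using V_sub by (auto simp: W_iff)

lemma psi_W: "g \<in> GW \<Longrightarrow> psi g \<in> W"
  using psi_path[of g] path_carrier(1)[of "psi g"] by simp

lemma blk_rev: "rev (blk p q) = blk q p"
  by (simp add: blk_def)

lemma blk_tau:
  assumes "(p, q) \<in> F"
  shows "blk p q @ tau q \<approx> tau p @ [q]"
proof -
  have V: "p \<in> V" "q \<in> V" using assms by (auto simp: F_iff)
  show ?thesis
    using sim_context[OF rev_path_sim[OF tau_path[OF V(2)]], of "tau p" "[]"] path_carrier[OF tau_path[OF V(1)]]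
      tau(3)[OF V(2)] by (simp add: blk_def)
qed

text \<open>Crossing a tree edge keeps the whole loop inside the tree, so it is a closed tree
  walk.\<close>

lemma blk_adj: "adj p q \<Longrightarrow> blk p q \<approx> [p0]"
proof -
  assume a: "adj p q"
  have V: "p \<in> V" "q \<in> V" using adj_F[OF a] by (auto simp: F_iff)
  have "walk (blk p q)"
    using tau[OF V(1)] tau[OF V(2)] walk_rev[of "tau q"] a
    by (auto simp: blk_def successively_append_iff hd_rev)
  then show ?thesis
    using closed_walk_sim[of "blk p q"] blk_path[OF adj_F[OF a]] by simp
qed

lemma blk_triangle:
  assumes "linked_triangle P V s u w"
  shows "blk u s @ blk s w \<approx> blk u w"
proof -
  have F: "(u, s) \<in> F" "(s, w) \<in> F" and V: "u \<in> V" "s \<in> V" "w \<in> V"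
    using assms by (auto simp: linked_triangle_def)
  note c = path_carrier(2)[OF tau_path[OF V(1)]] path_carrier(2)[OF tau_path[OF V(3)]]
  \<comment> \<open>Exposing the end of \<open>tau u\<close> and the start of the reversed
    \<open>tau w\<close> brings \<open>[u, s, w]\<close> together once the detour along
    \<open>tau s\<close> has folded.\<close>
  have u: "tau u = butlast (tau u) @ [u]" using tau[OF V(1)] by (metis append_butlast_last_id)
  have w: "rev (tau w) = [w] @ tl (rev (tau w))"
    using tau[OF V(3)] by (metis append_Cons append_Nil hd_rev list.collapse rev_is_Nil_conv)
  have c': "set (butlast (tau u)) \<subseteq> carrier P" "set (tl (rev (tau w))) \<subseteq> carrier P"
    using c list.set_sel(2)[of "rev (tau w)"] tau(1)[OF V(3)] by (auto dest: in_set_butlastD)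
  have "blk u s @ blk s w \<approx> (tau u @ [s]) @ rev (tau w)"
    using sim_context[OF blk_tau[OF F(1)], of "[]" "rev (tau w)"] c by (simp add: blk_def)
  also have "(tau u @ [s]) @ rev (tau w) = butlast (tau u) @ [u, s, w] @ tl (rev (tau w))"
    by (subst u, subst w) simp
  finally have "blk u s @ blk s w \<approx> butlast (tau u) @ [u, s, w] @ tl (rev (tau w))" .
  moreover have "butlast (tau u) @ [u, s, w] @ tl (rev (tau w)) \<approx>
      butlast (tau u) @ [u, w] @ tl (rev (tau w))"
    by (rule sim_context[OF sim_triangle[OF assms] c'])
  moreover have "butlast (tau u) @ [u, w] @ tl (rev (tau w)) = blk u w"
    unfolding blk_def by (subst (2) u, subst (2) w) simp
  ultimately show ?thesis by (auto intro: word_cong.trans)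
qed

lemma psi_append:
  assumes "u \<in> GW" "v \<in> GW"
  shows "psi (u @ v) \<approx> psi u @ psi v"
  using assms(1)
proof (induction u)
  case Nil
  show ?case using path_hd_absorb[of "psi v"] psi_path[OF assms(2)] by (auto intro: word_cong.sym)
next
  case (Cons x u)
  then show ?case
    using sim_context[of "psi (u @ v)" "psi u @ psi v" "letter x" "[]"] path_carrier letter_path by auto
qed

lemma psi_base:
  assumes "letter x \<approx> [p0]" shows "psi [x] \<approx> psi []"
  using sim_context[OF assms, of "[]" "[p0]"] sim_idem[of p0] p0_V V_sub
  by (auto intro: word_cong.trans)

lemma psi_cong: "u \<sim> v \<Longrightarrow> psi u \<approx> psi v"
proof (induction rule: word_cong.induct)
  case (base u v)
  have p0: "p0 \<in> carrier P" using p0_V V_sub by auto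
  note uv = base(2,3)
  from base(1) show ?case
    unfolding cancellations_def subgroup_rels_def
  proof (elim UnE CollectE exE conjE Pair_inject)
    fix y b assume c: "u = [(y, b), (y, \<not> b)]" "v = []" "y \<in> F"
    have l: "letter (y, \<not> b) = rev (letter (y, b))" by (cases y) (simp add: blk_rev)
    have "letter (y, b) @ letter (y, \<not> b) \<approx> [p0]"
      using path_rev_sim[of "letter (y, b)"] letter_path[of "(y, b)"] c(3) unfolding l by simp
    from sim_context[OF this, of "[]" "[p0]"] have "psi u \<approx> [p0, p0]" using c(1) p0 by simp
    then show ?thesis using sim_trans[OF _ sim_idem[OF p0]] c(2) by simp
  next
    fix p q assume "u = [gen p q]" "v = []" "(p, q) \<in> T"
    then show ?thesis using psi_base[of "gen p q"] blk_adj[of p q] by (simp add: adj_def)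
  next
    fix p assume r: "u = [gen p p]" "v = []" "p \<in> V"
    then have "blk p p \<approx> [p0]"
      using path_rev_sim[OF tau_path[of p]] tau(2)[of p] by (simp add: blk_def)
    then show ?thesis using psi_base[of "gen p p"] r by simp
  next
    \<comment> \<open>Both letters are sent to \<open>blk p q\<close> by definition, so reflexivity
      suffices.\<close>
    fix p q assume "u = [gen p q]" "v = [gen_inv q p]"
    then show ?thesis using word_cong.refl[OF psi_W[OF uv(1)]] by simp
  next
    fix s x w assume "u = [gen x s, gen s w]" "v = [gen x w]" and t: "linked_triangle P V s x w"
    then show ?thesis using sim_context[OF blk_triangle[OF t], of "[]" "[p0]"] p0 by simp
  qed
next
  case (refl u)
  then show ?case by (intro word_cong.refl psi_W)
next
  case (append u v u' v')
  have i: "u \<in> GW" "v \<in> GW" "u' \<in> GW" "v' \<in> GW"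
    using gsim_in[OF append(1)] gsim_in[OF append(2)] by auto
  have "psi (u @ u') \<approx> psi u @ psi u'" by (rule psi_append[OF i(1,3)])
  also have "psi u @ psi u' \<approx> psi v @ psi v'" by (rule word_cong.append[OF append(3,4)])
  also have "psi v @ psi v' \<approx> psi (v @ v')" by (rule word_cong.sym[OF psi_append[OF i(2,4)]])
  finally show ?case .
qed (auto intro: word_cong.sym word_cong.trans)

section \<open>The action on the representing words\<close>

lemma run_path:
  "path (q # xs) \<Longrightarrow> ok q xs \<and> fin q xs = last (q # xs) \<and> (successively adj (q # xs) \<longrightarrow> lab q xs \<sim> [])"
proof (induction xs arbitrary: q)
  case (Cons x xs)
  then have F: "(q, x) \<in> F" and p: "path (x # xs)" by auto
  have a: "act P q x = q" "act P x q = x" using F by (auto simp: F_iff)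
  have "gen q x # lab x xs \<sim> []" if "successively adj (q # x # xs)"
    using gsim_append[of "[gen q x]" "[]" "lab x xs" "[]"] g_adj[of q x] Cons.IH[OF p] that by simp
  then show ?case using Cons.IH[OF p] a by simp
qed (auto intro: word_cong.refl)

text \<open>Only the edge entering the walk from \<open>q\<close> contributes, since tree edges have
  trivial labels.\<close>

lemma run_walk:
  assumes "walk xs" "(q, hd xs) \<in> F"
  shows "ok q xs" "fin q xs = last xs" "lab q xs \<sim> [gen q (hd xs)]"
proof -
  obtain x ys where xs: "xs = x # ys" using assms(1) by (cases xs) auto
  have a: "act P q x = q" "act P x q = x" using assms(2) xs by (auto simp: F_iff)
  have r: "ok x ys" "fin x ys = last xs" "lab x ys \<sim> []"
    using run_path[of x ys] walk_path[OF assms(1)] assms(1) xs by auto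
  show "ok q xs" "fin q xs = last xs" using r a xs by auto
  show "lab q xs \<sim> [gen q (hd xs)]"
    using gsim_append[OF word_cong.refl[of "[gen q x]"] r(3)] assms(2) a xs by simp
qed

text \<open>The outward walk is entered from \<open>p0\<close> itself and contributes a trivial
  loop; the return is entered at \<open>q\<close> from \<open>p\<close> and contributes the
  generator.\<close>

lemma run_blk:
  assumes "(p, q) \<in> F"
  shows "ok p0 (blk p q)" "fin p0 (blk p q) = p0" "lab p0 (blk p q) \<sim> [gen p q]"
proof -
  have V: "p \<in> V" "q \<in> V" using assms by (auto simp: F_iff)
  have w: "walk (tau p)" "walk (rev (tau q))" using tau[OF V(1)] tau[OF V(2)] walk_rev by blast+
  have h: "hd (rev (tau q)) = q" "last (rev (tau q)) = p0"
    using tau[OF V(2)] by (auto simp: hd_rev last_rev)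
  have p: "ok p0 (tau p)" "fin p0 (tau p) = p" "lab p0 (tau p) \<sim> [gen p0 p0]"
    using run_walk[OF w(1), of p0] tau[OF V(1)] F_refl[OF p0_V] by auto
  have q: "ok p (rev (tau q))" "fin p (rev (tau q)) = p0" "lab p (rev (tau q)) \<sim> [gen p q]"
    using run_walk[OF w(2), of p] h assms by auto
  show "ok p0 (blk p q)" "fin p0 (blk p q) = p0" using p q by (auto simp: blk_def)
  have "lab p0 (tau p) \<sim> []" using p(3) g_refl[OF p0_V] by (rule word_cong.trans)
  then show "lab p0 (blk p q) \<sim> [gen p q]"
    using gsim_append[OF _ q(3)] p by (fastforce simp: blk_def)
qed

lemma run_letter:
  assumes "fst x \<in> F"
  shows "ok p0 (letter x) \<and> fin p0 (letter x) = p0 \<and> lab p0 (letter x) \<sim> [x]"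
proof -
  obtain p q b where x: "x = ((p, q), b)" by (cases x rule: letter.cases)
  then have F: "(p, q) \<in> F" "(q, p) \<in> F" using assms F_sym by auto
  show ?thesis
    using x run_blk[OF F(1)] run_blk[OF F(2)] word_cong.trans[OF _ g_inv[OF F(2)]] by auto
qed

text \<open>Reading labels from \<open>p0\<close> undoes \<open>psi\<close>, which gives
  injectivity.\<close>

lemma run_psi: "g \<in> GW \<Longrightarrow> ok p0 (psi g) \<and> fin p0 (psi g) = p0 \<and> lab p0 (psi g) \<sim> g"
proof (induction g)
  case Nil
  then show ?case using p0_V V_sub g_refl by (auto simp: act_self)
next
  case (Cons x g)
  then show ?case
    using run_letter[of x] gsim_append[of "lab p0 (letter x)" "[x]" "lab p0 (psi g)" g] by auto
qed

text \<open>Each letter splits off the loop of its label on the left and leaves the tree walk to the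
  new vertex. At \<open>p0\<close> this gives surjectivity.\<close>

lemma tau_run:
  "q \<in> V \<Longrightarrow> set w \<subseteq> carrier P \<Longrightarrow> ok q w \<Longrightarrow> tau q @ w \<approx> psi (lab q w) @ tau (fin q w)"
proof (induction w arbitrary: q)
  case Nil
  then show ?case
    using path_hd_absorb[OF tau_path[of q]] tau(2)[of q] by (auto intro: word_cong.sym)
next
  case (Cons p w)
  let ?r = "act P p q"
  have q: "q \<in> V" and p: "p \<in> carrier P" and w: "set w \<subseteq> carrier P" "ok ?r w" using Cons by auto
  have F: "(q, ?r) \<in> F" using F_act Cons.prems by simp
  have r: "?r \<in> V" using F by (simp add: F_iff)
  have qc: "q \<in> carrier P" using q V_sub by auto
  have t: "tau q = butlast (tau q) @ [q]" using tau[OF q] by (metis append_butlast_last_id)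
  have c: "set (tau q) \<subseteq> carrier P" "set (blk q ?r) \<subseteq> carrier P"
    using path_carrier(2) tau_path[OF q] blk_path(1)[OF F] by blast+
  then have c': "set (butlast (tau q)) \<subseteq> carrier P" by (auto dest: in_set_butlastD)
  have "tau q @ [p] \<approx> tau q @ [?r]"
    using sim_context[OF sim_step[OF qc p] c', of "[]"] by (subst (1 2) t) simp
  also have "tau q @ [?r] \<approx> blk q ?r @ tau ?r" by (rule word_cong.sym[OF blk_tau[OF F]])
  finally have "tau q @ p # w \<approx> blk q ?r @ tau ?r @ w"
    using sim_context[of "tau q @ [p]" "blk q ?r @ tau ?r" "[]" w] w by simp
  also have "blk q ?r @ tau ?r @ w \<approx> blk q ?r @ psi (lab ?r w) @ tau (fin ?r w)"
    using sim_context[OF Cons.IH[OF r w] c(2), of "[]"] by simp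
  finally show ?case by simp
qed

subsection \<open>The isomorphism\<close>

definition cls :: "'a list \<Rightarrow> 'a list set" where
  "cls w = word_cong W (PG_rels P) `` {w}"

definition gcls :: "(('a \<times> 'a) \<times> bool) list \<Rightarrow> (('a \<times> 'a) \<times> bool) list set" where
  "gcls g = word_cong GW G_rels `` {g}"

lemma cls_eq: "u \<in> W \<Longrightarrow> v \<in> W \<Longrightarrow> cls u = cls v \<longleftrightarrow> u \<approx> v"
  unfolding cls_def by (rule eq_equiv_class_iff[OF word_cong_equiv[OF W_append]])

lemma gcls_eq: "u \<in> GW \<Longrightarrow> v \<in> GW \<Longrightarrow> gcls u = gcls v \<longleftrightarrow> u \<sim> v"
  unfolding gcls_def by (rule eq_equiv_class_iff[OF word_cong_equiv[OF GW_append]])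

lemma PG_simps: "carrier (PG P) = cls ` W" "PG_gen P p = cls [p]"
  "u \<in> W \<Longrightarrow> v \<in> W \<Longrightarrow> cls u \<cdot>\<^bsub>PG P\<^esub> cls v = cls (u @ v)"
  by (auto simp: PG_def semigroup_presentation_def Let_def quotient_def cls_def PG_gen_def
      class_mult_class[OF W_append])

abbreviation "Grp \<equiv> group_presentation F (subgroup_rels P V T)"

lemma Grp_simps: "carrier Grp = gcls ` GW"
  "u \<in> GW \<Longrightarrow> v \<in> GW \<Longrightarrow> gcls u \<otimes>\<^bsub>Grp\<^esub> gcls v = gcls (u @ v)"
  by (auto simp: group_presentation_def Let_def quotient_def gcls_def class_mult_class[OF GW_append])

abbreviation "Sub \<equiv> maximal_subgroup (PG P) (PG_gen P p0)"

lemma Sub_iff: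
  assumes w: "w \<in> W"
  shows "cls w \<in> carrier Sub \<longleftrightarrow> w @ [p0] \<approx> w \<and> [p0] @ w \<approx> w \<and>
    (\<exists>y \<in> W. y @ w \<approx> [p0]) \<and> (\<exists>y \<in> W. w @ y \<approx> [p0])"
proof -
  interpret is_semigroup "PG P"
    unfolding PG_def by (rule semigroup_presentation_is_semigroup)
  have p0: "[p0] \<in> W" using p0_V V_sub by (auto simp: W_iff)
  have p0w: "p0 # w \<in> W" using w p0 by (simp add: W_iff)
  have e: "cls [p0] \<in> carrier (PG P)" "cls [p0] \<cdot>\<^bsub>PG P\<^esub> cls [p0] = cls [p0]"
    using p0 sim_idem[of p0] W_append[OF p0 p0] by (auto simp: PG_simps cls_eq W_iff)
  show ?thesis
    using green_H_idem_iff[OF e, of "cls w"] w p0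
      p0w by (simp add: maximal_subgroup_def PG_simps(1,2)) (simp add: PG_simps cls_eq W_append)
qed

text \<open>As \<open>psi g\<close> is a friendly path from \<open>p0\<close> to \<open>p0\<close>,
  its reversal is an inverse on both sides.\<close>

lemma psi_Sub: "g \<in> GW \<Longrightarrow> cls (psi g) \<in> carrier Sub"
proof -
  assume g: "g \<in> GW"
  have p: "path (psi g)" "hd (psi g) = p0" "last (psi g) = p0" using psi_path[OF g] by auto
  have W: "rev (psi g) \<in> W" using path_carrier(1)[OF path_rev[OF p(1)]] .
  have "psi g @ [p0] \<approx> psi g" "[p0] @ psi g \<approx> psi g"
    "rev (psi g) @ psi g \<approx> [p0]" "psi g @ rev (psi g) \<approx> [p0]"
    using path_rev_sim[OF p(1)] rev_path_sim[OF p(1)] path_hd_absorb[OF p(1)] path_last_absorb[OF p(1)]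
    unfolding p(2,3) by simp_all
  then show ?thesis
    unfolding Sub_iff[OF psi_W[OF g]] using W by (intro conjI bexI) assumption+
qed

text \<open>An element of the maximal subgroup maps \<open>p0\<close> to some \<open>q\<close> below \<open>p0\<close>, and its left
  inverse shows \<open>p0\<close> to be below \<open>q\<close>.\<close>

lemma Sub_run:
  assumes w: "w \<in> W" and S: "cls w \<in> carrier Sub"
  shows "ok p0 w" "fin p0 w = p0"
proof -
  have p0: "p0 \<in> V" "p0 \<in> carrier P" using p0_V V_sub by auto
  obtain y z where y: "y \<in> W" "y @ w \<approx> [p0]" and z: "w @ z \<approx> [p0]"
    and wp: "w @ [p0] \<approx> w" and pw: "[p0] @ w \<approx> w"
    using S Sub_iff[OF w] by blast
  have ok0: "ok p0 [p0]" "fin p0 [p0] = p0" using p0 by (auto simp: act_self)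
  show ok: "ok p0 w" using sim_agree[OF z] p0(1) ok0 unfolding agree_def by auto
  have okw: "ok p0 (w @ [p0])" "fin p0 (w @ [p0]) = fin p0 w"
    using sim_agree[OF wp] p0(1) ok unfolding agree_def by auto
  have qc: "fin p0 w \<in> carrier P" using fin_in p0 w by (simp add: W_iff)
  have le: "act P p0 (fin p0 w) = fin p0 w" using okw by simp
  define r where "r = fin p0 y"
  have yw: "ok p0 (y @ w)" "fin p0 (y @ w) = p0"
    using sim_agree[OF y(2)] p0(1) ok0 unfolding agree_def by auto
  then have r: "r \<in> V" "ok r w" "fin r w = p0"
    using run_closed[of p0 y] p0 y(1) by (auto simp: r_def W_iff)
  have "ok r ([p0] @ w)" "fin r ([p0] @ w) = p0"
    using sim_agree[OF pw] r unfolding agree_def by auto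
  then have "fin (act P p0 r) w = p0" by simp
  moreover have "act P (fin p0 w) (fin (act P p0 r) w) = fin (act P p0 r) w"
    using fin_mono[of p0 "act P p0 r" w] p0 r(1) V_sub w by (auto simp: act_closed act_idem W_iff)
  ultimately have "act P (fin p0 w) p0 = p0" by simp
  then show "fin p0 w = p0" using act_le_antisym[OF p0(2) qc le] by simp
qed

text \<open>This is \<open>tau_run\<close> at \<open>p0\<close>: the action of \<open>w\<close>
  fixes \<open>p0\<close>, and \<open>tau p0\<close> collapses to \<open>[p0]\<close>, the identity
  of the subgroup.\<close>

lemma Sub_psi:
  assumes w: "w \<in> W" and S: "cls w \<in> carrier Sub"
  shows "lab p0 w \<in> GW" "psi (lab p0 w) \<approx> w"
proof -
  note r = Sub_run[OF assms]
  have wc: "set w \<subseteq> carrier P" using w by (simp add: W_iff)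
  show g: "lab p0 w \<in> GW" using run_closed[OF p0_V wc r(1)] by blast
  have "tau p0 \<approx> [p0]" using closed_walk_sim tau[OF p0_V] by metis
  then have 1: "tau p0 @ w \<approx> [p0] @ w" "psi (lab p0 w) @ tau p0 \<approx> psi (lab p0 w) @ [p0]"
    using sim_context[of "tau p0" "[p0]" "[]" w] sim_context[of "tau p0" "[p0]" "psi (lab p0 w)" "[]"]
      wc path_carrier(2) psi_path[OF g] by auto
  have "psi (lab p0 w) \<approx> psi (lab p0 w) @ [p0]"
    using path_last_absorb psi_path[OF g] by (metis word_cong.sym)
  also have "psi (lab p0 w) @ [p0] \<approx> psi (lab p0 w) @ tau p0" using 1(2) by (rule word_cong.sym)
  also have "psi (lab p0 w) @ tau p0 \<approx> tau p0 @ w" using tau_run[OF p0_V wc r(1)] r(2) by (auto intro: word_cong.sym)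
  also note 1(1)
  also have "[p0] @ w \<approx> w" using S Sub_iff[OF w] by blast
  finally show "psi (lab p0 w) \<approx> w" .
qed

text \<open>The union over all representatives avoids a choice; its members coincide by
  \<open>psi_cong\<close>.\<close>

definition psi_hom :: "(('a \<times> 'a) \<times> bool) list set \<Rightarrow> 'a list set" where
  "psi_hom A = (\<Union>g \<in> A. cls (psi g))"

lemma psi_hom_gcls:
  assumes "g \<in> GW"
  shows "psi_hom (gcls g) = cls (psi g)"
proof -
  have "cls (psi h) = cls (psi g)" if "h \<in> gcls g" for h
    using that psi_cong[of g h] sim_in[OF psi_cong[of g h]] assms psi_W
    by (auto simp: gcls_def cls_eq word_cong.sym)
  moreover have "g \<in> gcls g" using assms by (simp add: gcls_def word_cong.refl)
  ultimately show ?thesis unfolding psi_hom_def by blast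
qed

lemma psi_hom_iso: "psi_hom \<in> iso Grp Sub"
proof -
  have m: "mult Sub = sprod (PG P)" by (simp add: maximal_subgroup_def)
  have "psi_hom \<in> hom Grp Sub"
  proof (rule homI)
    fix A assume "A \<in> carrier Grp"
    then show "psi_hom A \<in> carrier Sub" using psi_hom_gcls psi_Sub by (auto simp: Grp_simps)
  next
    fix A B assume "A \<in> carrier Grp" "B \<in> carrier Grp"
    then obtain g h where gh: "g \<in> GW" "h \<in> GW" "A = gcls g" "B = gcls h" by (auto simp: Grp_simps)
    then show "psi_hom (A \<otimes>\<^bsub>Grp\<^esub> B) = psi_hom A \<otimes>\<^bsub>Sub\<^esub> psi_hom B"
      unfolding m using psi_append[of g h]
      by (simp add: Grp_simps psi_hom_gcls GW_append PG_simps psi_W cls_eq W_append)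
  qed
  moreover have "inj_on psi_hom (carrier Grp)"
  proof (rule inj_onI)
    fix A B assume "A \<in> carrier Grp" "B \<in> carrier Grp" and e: "psi_hom A = psi_hom B"
    then obtain g h where gh: "g \<in> GW" "h \<in> GW" "A = gcls g" "B = gcls h" by (auto simp: Grp_simps)
    then have "psi g \<approx> psi h" using e by (simp add: psi_hom_gcls cls_eq psi_W)
    then have "lab p0 (psi g) \<sim> lab p0 (psi h)"
      using sim_agree p0_V run_psi[OF gh(1)] unfolding agree_def by blast
    then have "g \<sim> h"
      using run_psi[OF gh(1)] run_psi[OF gh(2)] by (meson word_cong.sym word_cong.trans)
    then show "A = B" using gh gcls_eq by simp
  qed
  moreover have "carrier Sub \<subseteq> psi_hom ` carrier Grp"
  proof
    fix X assume X: "X \<in> carrier Sub"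
    then have "X \<in> carrier (PG P)" by (auto simp: maximal_subgroup_def green_H_def green_L_def)
    then obtain w where w: "w \<in> W" "X = cls w" by (auto simp: PG_simps)
    note s = Sub_psi[OF w(1) X[unfolded w(2)]]
    have "X = psi_hom (gcls (lab p0 w))"
      using s w by (simp add: psi_hom_gcls cls_eq psi_W word_cong.sym)
    then show "X \<in> psi_hom ` carrier Grp" using s(1) by (auto simp: Grp_simps)
  qed
  ultimately show ?thesis unfolding iso_def bij_betw_def hom_def by auto
qed

end

theorem corollary6p42:
  fixes P :: "'a proj_algebra"
    and S :: "'a star_semigrp"
    and p0 :: 'a
    and D PD :: "'a set"
    and T :: "('a \<times> 'a) set"
  assumes "projection_algebra P"
    and "regular_star_semigroup S"
    and "projection_generated S"
    and "is_projection_algebra_of P S"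
    and "p0 \<in> carrier P"
    and "D = green_D S `` {p0}"
    and "PD = carrier P \<inter> D"
    and "rooted_spanning_tree PD (friendly_on P PD) p0 T"
  shows "maximal_subgroup (PG P) (PG_gen P p0)
           \<cong> group_presentation (friendly_on P PD) (subgroup_rels P PD T)"
proof -
  interpret S: regular_star_semigroup S by fact
  interpret projection_algebra P by fact
  interpret friendly_component P PD p0 T
  proof
    fix q r assume q: "q \<in> PD" and f: "(q, r) \<in> friendly P"
    have "(p0, r) \<in> green_D S"
      using S.green_D_friendly[OF assms(4,5) _ f] q assms(6,7) by blast
    then show "r \<in> PD" using f assms(6,7) by (auto simp: friendly_def)
  qed (use assms in auto)
  show ?thesis
    using group.iso_sym[OF group_presentation_is_group] is_isoI[OF psi_hom_iso] by blast
qed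

end
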